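(* Let $n \geq 2$ and $k \geq 0$. Let $X$ be the set of C-multidissections of the regular $2n$-gon $\mathbb{P}_{2n}$ with $k$ edges and let the cyclic group $C = \mathbb{Z}_n$ of order $n$ act on $X$ by rotation. Then the triple $(X, C, X(q))$ exhibits the cyclic sieving phenomenon, where $$X(q) = h_{(k,k)}(1,q,\dots,q^{n-1}).$$
   Context: Cyclic sieving phenomenon (CSP): let $X$ be a finite set, let $C = \langle c \rangle$ be a finite cyclic group acting on $X$ with distinguished generator $c$, and let $X(q) \in \mathbb{N}[q]$. Let $\zeta \in \mathbb{C}$ be a root of unity with the same multiplicative order as $c$. The triple $(X,C,X(q))$ exhibits the CSP if for all integers $d \geq 0$ the number of elements of $X$ fixed by $c^d$ equals $X(\zeta^d)$. C-multidissections: an edge of the regular $2n$-gon $\mathbb{P}_{2n}$ is a segment joining two distinct vertices (boundary sides included), and two edges cross if they are distinct and meet at a point interior to both. A C-edge in $\mathbb{P}_{2n}$ is either a pair of centrally symmetric nondiameter edges (which may be on the boundary) or a diameter of $\mathbb{P}_{2n}$. Two C-edges cross if some edge belonging to the first crosses some edge belonging to the second. Let $E_C$ be the set of C-edges. A C-multidissection of $\mathbb{P}_{2n}$ is a function $f: E_C \to \mathbb{N}=\{0,1,2,\dots\}$ such that for any pair $e,e'$ of crossing C-edges, $f(e)=0$ or $f(e')=0$. It has $k$ edges if $\sum_{e\in E_C} f(e) = k$ (so a centrally symmetric pair counts as a single edge). The distinguished generator of $\mathbb{Z}_n$ acts by the one-step rotation of $\mathbb{P}_{2n}$ (by angle $2\pi/(2n)$);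 its $n$-th power fixes every C-edge, so this is an action of $\mathbb{Z}_n$. $h_k(x_1,\dots,x_n) = \sum_{1 \le i_1 \le \cdots \le i_k \le n} x_{i_1}\cdots x_{i_k}$ is the complete homogeneous symmetric polynomial ($h_0=1$), and $h_{(k,k)} = h_k \cdot h_k$. *)

theory Defs
  imports
    "HOL-Analysis.Analysis"
    "HOL-Computational_Algebra.Polynomial"
    "HOL-Algebra.Group_Action"
    "HOL-Algebra.Elementary_Groups"
    "HOL-Algebra.Multiplicative_Group"
begin

section \<open>The cyclic sieving phenomenon\<close>

definition has_mult_order :: "complex \<Rightarrow> nat \<Rightarrow> bool" where
  "has_mult_order z m \<longleftrightarrow> 0 < m \<and> z ^ m = 1 \<and> (\<forall>j. 0 < j \<and> j < m \<longrightarrow> z ^ j \<noteq> 1)"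

text \<open>
  The standing assumptions on the triple (finiteness, \<open>c\<close> generates \<open>G\<close>, \<open>G\<close> acts on \<open>X\<close>) are
  part of the predicate, and the evaluation is required at every root of unity of the right order.
\<close>

definition exhibits_csp ::
    "('g, 'm) monoid_scheme \<Rightarrow> 'g \<Rightarrow> ('g \<Rightarrow> 'x \<Rightarrow> 'x) \<Rightarrow> 'x set \<Rightarrow> nat poly \<Rightarrow> bool" where
  "exhibits_csp G c \<phi> X P \<longleftrightarrow>
     finite X \<and> finite (carrier G) \<and> c \<in> carrier G \<and> carrier G = generate G {c} \<and>
     group_action G X \<phi> \<and>
     (\<forall>\<zeta>. has_mult_order \<zeta> (group.ord G c) \<longrightarrow>
        (\<forall>d::nat. of_nat (card (invariants X \<phi> (c [^]\<^bsub>G\<^esub> d))) =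
                  poly (map_poly of_nat P) (\<zeta> ^ d)))"


section \<open>C-multidissections of the regular \<open>2n\<close>-gon\<close>

text \<open>
  The polygon is inscribed in the unit circle of the complex plane, so that its central symmetry is
  \<open>uminus\<close> and the rotation by an angle \<open>\<theta>\<close> is multiplication by \<open>cis \<theta>\<close>. Edges are
  closed segments, viewed as subsets of the plane; the interior points of a segment are those of
  its \<open>rel_interior\<close>.
\<close>

definition polygon_vertices :: "nat \<Rightarrow> complex set" where
  "polygon_vertices n = {cis (2 * pi * real i / real (2 * n)) | i. i < 2 * n}"

definition polygon_edges :: "nat \<Rightarrow> complex set set" where
  "polygon_edges n =
     {closed_segment a b | a b. a \<in> polygon_vertices n \<and> b \<in> polygon_vertices n \<and> a \<noteq> b}"

definition edges_cross :: "complex set \<Rightarrow> complex set \<Rightarrow> bool" where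
  "edges_cross e e' \<longleftrightarrow> e \<noteq> e' \<and> rel_interior e \<inter> rel_interior e' \<noteq> {}"

definition diameters :: "nat \<Rightarrow> complex set set" where
  "diameters n = {closed_segment a (- a) | a. a \<in> polygon_vertices n}"

text \<open>A C-edge is encoded as the set of the (one or two) edges it consists of.\<close>

definition c_edges :: "nat \<Rightarrow> complex set set set" where
  "c_edges n =
     {{e, uminus ` e} | e. e \<in> polygon_edges n \<and> e \<notin> diameters n} \<union> {{e} | e. e \<in> diameters n}"

definition c_edges_cross :: "complex set set \<Rightarrow> complex set set \<Rightarrow> bool" where
  "c_edges_cross E E' \<longleftrightarrow> (\<exists>e\<in>E. \<exists>e'\<in>E'. edges_cross e e')"

definition c_multidissections :: "nat \<Rightarrow> nat \<Rightarrow> (complex set set \<Rightarrow> nat) set" where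
  "c_multidissections n k =
     {f \<in> c_edges n \<rightarrow>\<^sub>E UNIV.
        (\<forall>E\<in>c_edges n. \<forall>E'\<in>c_edges n. c_edges_cross E E' \<longrightarrow> f E = 0 \<or> f E' = 0) \<and>
        (\<Sum>E\<in>c_edges n. f E) = k}"

definition rotate_c_edge :: "real \<Rightarrow> complex set set \<Rightarrow> complex set set" where
  "rotate_c_edge \<theta> E = (\<lambda>e. (\<lambda>z. cis \<theta> * z) ` e) ` E"

text \<open>
  Rotating a multidissection moves the multiplicity of \<open>E\<close> to the rotated C-edge, hence the
  inverse rotation in the argument of \<open>f\<close>.
\<close>

definition rotate_multidissection ::
    "nat \<Rightarrow> (complex set set \<Rightarrow> nat) \<Rightarrow> complex set set \<Rightarrow> nat" where
  "rotate_multidissection n f = (\<lambda>E\<in>c_edges n. f (rotate_c_edge (- (2 * pi / real (2 * n))) E))"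

text \<open>
  The residue \<open>j\<close>, represented in \<open>{0..<int n}\<close>, acts by \<open>j\<close> rotation steps; the restriction is
  needed because the library's group actions map into extensional bijections.
\<close>

definition rotation_action ::
    "nat \<Rightarrow> nat \<Rightarrow> int \<Rightarrow> (complex set set \<Rightarrow> nat) \<Rightarrow> complex set set \<Rightarrow> nat" where
  "rotation_action n k j = restrict (rotate_multidissection n ^^ nat j) (c_multidissections n k)"


section \<open>Complete homogeneous symmetric polynomials\<close>

definition complete_homogeneous :: "nat \<Rightarrow> nat \<Rightarrow> (nat \<Rightarrow> 'a::comm_semiring_1) \<Rightarrow> 'a" where
  "complete_homogeneous k n x =
     (\<Sum>is \<in> {is. length is = k \<and> sorted is \<and> set is \<subseteq> {1..n}}. \<Prod>i\<leftarrow>is. x i)"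

definition complete_homogeneous_partition ::
    "nat list \<Rightarrow> nat \<Rightarrow> (nat \<Rightarrow> 'a::comm_semiring_1) \<Rightarrow> 'a" where
  "complete_homogeneous_partition ks n x = (\<Prod>k\<leftarrow>ks. complete_homogeneous k n x)"

end

theory Submission
  imports Defs "HOL-Computational_Algebra.Polynomial_FPS"
begin

text \<open>
  Number the vertices of the \<open>2n\<close>-gon by integers modulo \<open>2n\<close>. A C-edge is an arc from \<open>a\<close> to
  \<open>a + l\<close> with \<open>1 \<le> l \<le> n\<close> together with its antipode, so that it has a starting point \<open>a\<close> and an
  end point \<open>a + l\<close> modulo \<open>n\<close>, and \<open>l = n\<close> for diameters. Recording the multiset of starting
  points and the multiset of end points identifies the multidissections with \<open>k\<close> edges with pairs
  of \<open>k\<close>-element multisets of residues modulo \<open>n\<close>: a noncrossing family of arcs is the matching of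
  a cyclic parenthesis word and is recovered greedily, the shortest arcs first. The bijection
  commutes with rotation, so the fixed points of the \<open>d\<close>-th power of the generator are pairs of
  \<open>d\<close>-invariant multisets. If \<open>\<omega> = \<zeta>\<^sup>d\<close> has order \<open>m\<close> and \<open>n = g m\<close>, then the product of the
  \<open>1 - \<omega>\<^sup>i X\<close> for \<open>i < n\<close> is \<open>(1 - X\<^sup>m)\<^sup>g\<close>, whose inverse generates both the values of the \<open>h\<^sub>k\<close> at the
  powers of \<open>\<omega>\<close> and the numbers of invariant multisets.
\<close>

section \<open>Noncrossing periodic families of arcs\<close>

text \<open>An arc from \<open>a\<close> longer than \<open>l\<close> and an arc into
  \<open>a + int l\<close> longer than \<open>l\<close> interlace, so they cannot both occur. Hence
  at least one of the two sums reduces to its term of length \<open>l\<close>, and both contain that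
  term.\<close>

lemma noncrossing_multiplicity:
  fixes F :: "int \<Rightarrow> nat \<Rightarrow> nat"
  assumes nc: "\<And>a c l l'. \<lbrakk>l \<in> {1..n}; l' \<in> {1..n}; a < c; c < a + int l; a + int l < c + int l'\<rbrakk>
                 \<Longrightarrow> F a l = 0 \<or> F c l' = 0"
    and l: "l \<in> {1..n}"
  shows "F a l = min (\<Sum>j\<in>{l..n}. F a j) (\<Sum>j\<in>{l..n}. F (a + int l - int j) j)"
proof -
  have "(\<forall>j\<in>{Suc l..n}. F a j = 0) \<or> (\<forall>j\<in>{Suc l..n}. F (a + int l - int j) j = 0)"
  proof (rule ccontr)
    assume "\<not> ?thesis"
    then obtain i j where ij: "i \<in> {Suc l..n}" "j \<in> {Suc l..n}" "F a i \<noteq> 0" "F (a + int l - int j) j \<noteq> 0"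
      by blast
    then show False
      using nc[of j i "a + int l - int j" a] l by auto
  qed
  moreover have "(\<Sum>j\<in>{l..n}. F a j) = F a l + (\<Sum>j\<in>{Suc l..n}. F a j)"
    and "(\<Sum>j\<in>{l..n}. F (a + int l - int j) j) = F a l + (\<Sum>j\<in>{Suc l..n}. F (a + int l - int j) j)"
    using l by (simp_all add: sum.atLeast_Suc_atMost)
  ultimately show ?thesis
    by auto
qed

text \<open>Induction on the length. Removing the shorter arcs, already known to agree, from the
  prescribed numbers of starting and end points leaves the same two sums for \<open>F\<close> and
  for \<open>G\<close>, and by \<open>noncrossing_multiplicity\<close> these sums fix the
  multiplicity.\<close>

lemma noncrossing_determined:
  fixes F G :: "int \<Rightarrow> nat \<Rightarrow> nat"
  assumes F: "\<And>a c l l'. \<lbrakk>l \<in> {1..n}; l' \<in> {1..n}; a < c; c < a + int l; a + int l < c + int l'\<rbrakk>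
                \<Longrightarrow> F a l = 0 \<or> F c l' = 0"
    and G: "\<And>a c l l'. \<lbrakk>l \<in> {1..n}; l' \<in> {1..n}; a < c; c < a + int l; a + int l < c + int l'\<rbrakk>
                \<Longrightarrow> G a l = 0 \<or> G c l' = 0"
    and starts: "\<And>a. (\<Sum>j=1..n. F a j) = (\<Sum>j=1..n. G a j)"
    and ends: "\<And>b. (\<Sum>j=1..n. F (b - int j) j) = (\<Sum>j=1..n. G (b - int j) j)"
    and l: "l \<in> {1..n}"
  shows "F a l = G a l"
  using l
proof (induction l arbitrary: a rule: less_induct)
  case (less l)
  have split: "(\<Sum>j=1..n. f j) = (\<Sum>j\<in>{1..<l}. f j) + (\<Sum>j\<in>{l..n}. f j)" for f :: "nat \<Rightarrow> nat"
  proof -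
    have "{1..n} = {1..<l} \<union> {l..n}" using less.prems by auto
    moreover have "{1..<l} \<inter> {l..n} = {}" by auto
    ultimately show ?thesis by (metis finite_atLeastAtMost finite_atLeastLessThan sum.union_disjoint)
  qed
  have "(\<Sum>j\<in>{1..<l}. F a j) = (\<Sum>j\<in>{1..<l}. G a j)"
    and "(\<Sum>j\<in>{1..<l}. F (a + int l - int j) j) = (\<Sum>j\<in>{1..<l}. G (a + int l - int j) j)"
    using less by (auto intro!: sum.cong)
  then have rest: "(\<Sum>j\<in>{l..n}. F a j) = (\<Sum>j\<in>{l..n}. G a j)"
      "(\<Sum>j\<in>{l..n}. F (a + int l - int j) j) = (\<Sum>j\<in>{l..n}. G (a + int l - int j) j)"
    using starts[of a] ends[of "a + int l"] unfolding split by simp_all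
  have "F a l = min (\<Sum>j\<in>{l..n}. F a j) (\<Sum>j\<in>{l..n}. F (a + int l - int j) j)"
    by (rule noncrossing_multiplicity[OF F less.prems])
  also have "\<dots> = min (\<Sum>j\<in>{l..n}. G a j) (\<Sum>j\<in>{l..n}. G (a + int l - int j) j)"
    by (simp only: rest)
  also have "\<dots> = G a l"
    by (rule noncrossing_multiplicity[OF G less.prems, symmetric])
  finally show ?case .
qed

section \<open>Existence: greedy matching of starting points with end points\<close>

text \<open>
  The starting points and end points left over after all arcs of length at most \<open>l\<close> have been
  drawn with the largest possible multiplicities; truncated subtraction is intended.
\<close>

primrec unmatched :: "(int \<Rightarrow> nat) \<Rightarrow> (int \<Rightarrow> nat) \<Rightarrow> nat \<Rightarrow> (int \<Rightarrow> nat) \<times> (int \<Rightarrow> nat)" where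
  "unmatched s t 0 = (s, t)"
| "unmatched s t (Suc l) =
     (\<lambda>a. fst (unmatched s t l) a - snd (unmatched s t l) (a + int (Suc l)),
      \<lambda>b. snd (unmatched s t l) b - fst (unmatched s t l) (b - int (Suc l)))"

definition greedy_matching :: "(int \<Rightarrow> nat) \<Rightarrow> (int \<Rightarrow> nat) \<Rightarrow> int \<Rightarrow> nat \<Rightarrow> nat" where
  "greedy_matching s t a l =
     min (fst (unmatched s t (l - 1)) a) (snd (unmatched s t (l - 1)) (a + int l))"

text \<open>Truncated subtraction of \<open>y\<close> from \<open>x\<close> removes exactly
  \<open>min x y\<close>, so each round takes away as many points as it draws arcs. The same holds
  for the end points below.\<close>

lemma unmatched_starts_sum:
  "s a = fst (unmatched s t l) a + (\<Sum>j=1..l. greedy_matching s t a j)"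
  by (induction l) (auto simp: greedy_matching_def)

lemma unmatched_ends_sum:
  "t b = snd (unmatched s t l) b + (\<Sum>j=1..l. greedy_matching s t (b - int j) j)"
  by (induction l) (auto simp: greedy_matching_def)

lemma unmatched_antimono:
  assumes "l \<le> l'"
  shows "fst (unmatched s t l') a \<le> fst (unmatched s t l) a"
    and "snd (unmatched s t l') a \<le> snd (unmatched s t l) a"
  using assms by (induction rule: dec_induct) (auto intro: le_trans[OF diff_le_self])

text \<open>Round \<open>l\<close> exhausts one member of each pair at distance \<open>l\<close>,
  and later rounds never add points.\<close>

lemma unmatched_zero:
  assumes "1 \<le> l" "l \<le> m"
  shows "fst (unmatched s t m) a = 0 \<or> snd (unmatched s t m) (a + int l) = 0"
proof -
  obtain l' where l': "l = Suc l'" using assms by (cases l) auto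
  have "fst (unmatched s t l) a = 0 \<or> snd (unmatched s t l) (a + int l) = 0"
    unfolding l' by auto
  then show ?thesis
    using unmatched_antimono[OF assms(2), of s t a] unmatched_antimono[OF assms(2), of s t "a + int l"]
    by auto
qed

text \<open>For interlacing arcs the pair consisting of the start \<open>c\<close> and the end
  \<open>a + int l\<close> has a distance \<open>m\<close> smaller than both lengths. Round
  \<open>m\<close> exhausts one of the two points, so the longer arc that would need this point is
  drawn with multiplicity 0.\<close>

lemma greedy_matching_noncrossing:
  assumes "1 \<le> l" "1 \<le> l'" "a < c" "c < a + int l" "a + int l < c + int l'"
  shows "greedy_matching s t a l = 0 \<or> greedy_matching s t c l' = 0"
proof -
  define m where "m = nat (a + int l - c)"
  have m: "1 \<le> m" "m \<le> l - 1" "m \<le> l' - 1" "a + int l = c + int m"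
    using assms by (auto simp: m_def)
  from unmatched_zero[OF m(1) order_refl, of s t c] show ?thesis
    unfolding greedy_matching_def m(4)
    using unmatched_antimono(1)[OF m(3), of s t c] unmatched_antimono(2)[OF m(2), of s t "c + int m"]
    by auto
qed

section \<open>Functions on residues, treated as periodic functions on the integers\<close>

definition periodic :: "int \<Rightarrow> (int \<Rightarrow> 'a) \<Rightarrow> bool" where
  "periodic p f \<longleftrightarrow> (\<forall>a. f (a + p) = f a)"

lemma periodicD: "periodic p f \<Longrightarrow> f (a + p) = f a"
  by (simp add: periodic_def)

lemma periodic_multiple:
  assumes "periodic p f"
  shows "f (a + p * i) = f a"
proof (induction i rule: int_induct[where k = 0])
  case (step1 i)
  have "f (a + p * (i + 1)) = f ((a + p * i) + p)" by (simp add: algebra_simps)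
  then show ?case using step1 periodicD[OF assms] by metis
next
  case (step2 i)
  have "f (a + p * (i - 1)) = f ((a + p * (i - 1)) + p)" using periodicD[OF assms] by metis
  also have "\<dots> = f (a + p * i)" by (simp add: algebra_simps)
  finally show ?case using step2 by metis
qed simp

lemma periodic_mod: "periodic p f \<Longrightarrow> f (a mod p) = f a"
  using periodic_multiple[of p f "a mod p" "a div p"] by (simp add: mult.commute)

text \<open>By Bezout, being periodic modulo \<open>n\<close> and invariant under \<open>d\<close>
  rotation steps is periodicity modulo a single divisor of \<open>n\<close>.\<close>

lemma periodic_gcd:
  assumes "periodic p f" "periodic q f"
  shows "periodic (gcd p q) f"
  unfolding periodic_def
proof
  fix a
  obtain u v where "u * p + v * q = gcd p q" using bezout_int by blast
  then have "a + gcd p q = (a + p * u) + q * v" by (simp add: algebra_simps)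
  then show "f (a + gcd p q) = f a"
    using periodic_multiple[OF assms(1)] periodic_multiple[OF assms(2)] by metis
qed

lemma periodic_dvd: "p dvd q \<Longrightarrow> periodic p f \<Longrightarrow> periodic q f"
  by (auto simp: periodic_def[of q] periodic_multiple elim!: dvdE)

lemma sum_periodic_shift:
  fixes f :: "int \<Rightarrow> 'a::comm_monoid_add"
  assumes "periodic (int n) f"
  shows "(\<Sum>a\<in>{0..<int n}. f (a + c)) = (\<Sum>a\<in>{0..<int n}. f a)"
proof (cases "n = 0")
  case False
  have "(\<Sum>a\<in>{0..<int n}. f (a + c)) = (\<Sum>a\<in>{0..<int n}. f ((a + c) mod int n))"
    by (simp add: periodic_mod[OF assms])
  also have "\<dots> = (\<Sum>a\<in>{0..<int n}. f a)"
    by (rule sum.reindex_bij_witness[where i = "\<lambda>a. (a - c) mod int n" and j = "\<lambda>a. (a + c) mod int n"])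
       (use False in \<open>auto simp: mod_simps\<close>)
  finally show ?thesis .
qed simp

section \<open>Greedy matching of periodic data\<close>

lemma periodic_unmatched:
  assumes "periodic p s" "periodic p t"
  shows "periodic p (fst (unmatched s t l))" "periodic p (snd (unmatched s t l))"
proof (induction l)
  case (Suc l)
  have "fst (unmatched s t (Suc l)) (a + p) = fst (unmatched s t (Suc l)) a" for a
    using periodicD[OF Suc(1), of a] periodicD[OF Suc(2), of "a + int (Suc l)"]
    by (simp add: algebra_simps)
  moreover have "snd (unmatched s t (Suc l)) (a + p) = snd (unmatched s t (Suc l)) a" for a
    using periodicD[OF Suc(2), of a] periodicD[OF Suc(1), of "a - int (Suc l)"]
    by (simp add: algebra_simps)
  ultimately show "periodic p (fst (unmatched s t (Suc l)))" "periodic p (snd (unmatched s t (Suc l)))"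
    unfolding periodic_def by blast+
qed (use assms in simp_all)

lemma periodic_greedy_matching:
  assumes "periodic p s" "periodic p t"
  shows "periodic p (\<lambda>a. greedy_matching s t a l)"
  unfolding periodic_def
proof
  fix a
  show "greedy_matching s t (a + p) l = greedy_matching s t a l"
    using periodicD[OF periodic_unmatched(1)[OF assms], of "l - 1" a]
      periodicD[OF periodic_unmatched(2)[OF assms], of "l - 1" "a + int l"]
    by (simp add: greedy_matching_def add.assoc add.commute[of p])
qed

text \<open>For each fixed length the two sums over a period differ by a shift of the
  argument.\<close>

lemma sum_starts_eq_sum_ends:
  fixes F :: "int \<Rightarrow> nat \<Rightarrow> nat"
  assumes "\<And>l. l \<in> {1..n} \<Longrightarrow> periodic (int n) (\<lambda>a. F a l)"
  shows "(\<Sum>b\<in>{0..<int n}. \<Sum>l=1..n. F (b - int l) l) = (\<Sum>a\<in>{0..<int n}. \<Sum>l=1..n. F a l)"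
proof -
  have "(\<Sum>b\<in>{0..<int n}. F (b - int l) l) = (\<Sum>a\<in>{0..<int n}. F a l)" if "l \<in> {1..n}" for l
    using sum_periodic_shift[OF assms[OF that], of "- int l"] by simp
  then show ?thesis
    by (subst (1 2) sum.swap) (auto intro!: sum.cong)
qed

text \<open>Within \<open>n\<close> rounds every residue is compared with every other one, so a
  leftover starting point and a leftover end point cannot coexist. Equal totals leave equally many
  of both, hence none.\<close>

lemma greedy_matching_perfect:
  assumes per: "periodic (int n) s" "periodic (int n) t"
    and eq: "(\<Sum>a\<in>{0..<int n}. s a) = (\<Sum>a\<in>{0..<int n}. t a)"
    and n: "n \<ge> 1"
  shows "(\<Sum>j=1..n. greedy_matching s t a j) = s a"
    and "(\<Sum>j=1..n. greedy_matching s t (b - int j) j) = t b"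
proof -
  define S where "S = fst (unmatched s t n)"
  define T where "T = snd (unmatched s t n)"
  have pS: "periodic (int n) S" and pT: "periodic (int n) T"
    using periodic_unmatched[OF per] by (simp_all add: S_def T_def)
  have disj: "S a = 0 \<or> T b = 0" for a b
  proof -
    \<comment> \<open>The distance from \<open>a\<close> to \<open>b\<close> modulo
      \<open>n\<close>, normalised to \<open>{1..n}\<close> instead of \<open>{0..<n}\<close>:
      congruent points are joined by an arc of length \<open>n\<close>, a diameter.\<close>
    define l where "l = nat ((b - a - 1) mod int n) + 1"
    have l: "1 \<le> l" "l \<le> n"
      using n pos_mod_bound[of "int n" "b - a - 1"] pos_mod_sign[of "int n" "b - a - 1"]
      unfolding l_def by linarith+
    have "b = (a + int l) + int n * ((b - a - 1) div int n)"
      using n mod_mult_div_eq[of "b - a - 1" "int n"] by (auto simp: l_def)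
    then have "T b = T (a + int l)" using periodic_multiple[OF pT] by metis
    with unmatched_zero[OF l, of s t a] show ?thesis by (simp add: S_def T_def)
  qed
  have s: "s a = S a + (\<Sum>j=1..n. greedy_matching s t a j)" for a
    using unmatched_starts_sum[of s a t n] by (simp add: S_def)
  have t: "t b = T b + (\<Sum>j=1..n. greedy_matching s t (b - int j) j)" for b
    using unmatched_ends_sum[of t b s n] by (simp add: T_def)
  have sumeq: "(\<Sum>a\<in>{0..<int n}. S a) = (\<Sum>a\<in>{0..<int n}. T a)"
    using eq sum_starts_eq_sum_ends[of n "greedy_matching s t"] periodic_greedy_matching[OF per]
    by (simp add: s t sum.distrib)
  have "(\<forall>a. S a = 0) \<and> (\<forall>b. T b = 0)"
  proof -
    have "(\<Sum>a\<in>{0..<int n}. S a) = 0"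
    proof (cases "\<forall>a. S a = 0")
      case False
      then have "T b = 0" for b using disj by blast
      then show ?thesis using sumeq by simp
    qed simp
    then have "S (a mod int n) = 0" "T (a mod int n) = 0" for a
      using sumeq n by auto
    then show ?thesis using periodic_mod[OF pS] periodic_mod[OF pT] by auto
  qed
  then show "(\<Sum>j=1..n. greedy_matching s t a j) = s a"
    and "(\<Sum>j=1..n. greedy_matching s t (b - int j) j) = t b"
    using s t by simp_all
qed

section \<open>Complete homogeneous polynomials at roots of unity\<close>

text \<open>The largest entry of a sorted list is its last one. Splitting off the case where it is
  \<open>Suc n\<close> gives the recursion of the polynomials in the last variable.\<close>

lemma sorted_lists_last_cases:
  "{is. length is = Suc k \<and> sorted is \<and> set is \<subseteq> {1..Suc n}} =
     {is. length is = Suc k \<and> sorted is \<and> set is \<subseteq> {1..n}} \<union>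
     (\<lambda>is. is @ [Suc n]) ` {is. length is = k \<and> sorted is \<and> set is \<subseteq> {1..Suc n}}"
  (is "?L (Suc n) = ?L n \<union> ?R")
proof (intro equalityI subsetI)
  fix xs assume xs: "xs \<in> ?L (Suc n)"
  then obtain ys y where ys: "xs = ys @ [y]"
    by (cases xs rule: rev_cases) auto
  show "xs \<in> ?L n \<union> ?R"
  proof (cases "y = Suc n")
    case True
    then show ?thesis using xs ys by (intro UnI2 image_eqI[of _ _ ys]) (auto simp: sorted_append)
  next
    case False
    then have "xs \<in> ?L n" using xs ys by (fastforce simp: sorted_append)
    then show ?thesis by blast
  qed
next
  fix xs assume "xs \<in> ?L n \<union> ?R"
  then show "xs \<in> ?L (Suc n)"
  proof
    assume "xs \<in> ?R"
    then obtain ys where "xs = ys @ [Suc n]" "length ys = k" "sorted ys" "set ys \<subseteq> {1..Suc n}" by blast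
    then show ?thesis by (simp add: sorted_append subset_iff)
  qed auto
qed

lemma finite_sorted_lists: "finite {is. length is = k \<and> sorted is \<and> set is \<subseteq> {1..n::nat}}"
  by (rule finite_subset[OF _ finite_lists_length_eq[of "{1..n}" k]]) auto

lemma complete_homogeneous_0 [simp]: "complete_homogeneous 0 n x = 1"
proof -
  have "{is. length is = 0 \<and> sorted is \<and> set is \<subseteq> {1..n}} = {[]}" by auto
  then show ?thesis by (simp add: complete_homogeneous_def)
qed

lemma complete_homogeneous_no_vars: "complete_homogeneous (Suc k) 0 x = 0"
proof -
  have "{is. length is = Suc k \<and> sorted is \<and> set is \<subseteq> {1..0::nat}} = {}" by (auto simp: length_Suc_conv)
  then show ?thesis unfolding complete_homogeneous_def by (metis sum.empty)
qed

lemma complete_homogeneous_Suc: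
  "complete_homogeneous (Suc k) (Suc n) x =
     complete_homogeneous (Suc k) n x + x (Suc n) * complete_homogeneous k (Suc n) x"
proof -
  let ?L = "\<lambda>k n. {is. length is = k \<and> sorted is \<and> set is \<subseteq> {1..n::nat}}"
  have "complete_homogeneous (Suc k) (Suc n) x =
      (\<Sum>is\<in>?L (Suc k) n \<union> (\<lambda>is. is @ [Suc n]) ` ?L k (Suc n). \<Prod>i\<leftarrow>is. x i)"
    unfolding complete_homogeneous_def sorted_lists_last_cases ..
  also have "\<dots> = (\<Sum>is\<in>?L (Suc k) n. \<Prod>i\<leftarrow>is. x i) +
      (\<Sum>is\<in>(\<lambda>is. is @ [Suc n]) ` ?L k (Suc n). \<Prod>i\<leftarrow>is. x i)"
    by (rule sum.union_disjoint) (use finite_sorted_lists in auto)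
  also have "(\<Sum>is\<in>(\<lambda>is. is @ [Suc n]) ` ?L k (Suc n). \<Prod>i\<leftarrow>is. x i) =
      x (Suc n) * (\<Sum>is\<in>?L k (Suc n). \<Prod>i\<leftarrow>is. x i)"
    by (subst sum.reindex) (auto simp: inj_on_def sum_distrib_left mult.commute)
  finally show ?thesis by (simp add: complete_homogeneous_def)
qed

text \<open>Serves to move the evaluation of \<open>X(q)\<close> at a complex number inside the
  polynomial, onto its arguments. The recursion uses only sums and products, so semiring
  homomorphisms suffice.\<close>

lemma complete_homogeneous_hom:
  assumes "\<phi> 0 = 0" "\<phi> 1 = 1" "\<And>a b. \<phi> (a + b) = \<phi> a + \<phi> b" "\<And>a b. \<phi> (a * b) = \<phi> a * \<phi> b"
  shows "\<phi> (complete_homogeneous k n x) = complete_homogeneous k n (\<lambda>i. \<phi> (x i))"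
proof (induction n arbitrary: k)
  case 0
  then show ?case by (cases k) (simp_all add: assms complete_homogeneous_no_vars)
next
  case (Suc n)
  show ?case
    by (induction k) (simp_all add: assms complete_homogeneous_Suc Suc)
qed

text \<open>The classical generating function. The recursion says that multiplying the series by
  \<open>1 - fps_const (x (Suc n)) * fps_X\<close> removes the variable
  \<open>x (Suc n)\<close>.\<close>

lemma fps_complete_homogeneous:
  fixes x :: "nat \<Rightarrow> 'a::comm_ring_1"
  shows "Abs_fps (\<lambda>k. complete_homogeneous k n x) * (\<Prod>i=1..n. 1 - fps_const (x i) * fps_X) = 1"
proof (induction n)
  case 0
  have "Abs_fps (\<lambda>k. complete_homogeneous k 0 x) = 1"
  proof (rule fps_ext)
    fix k show "fps_nth (Abs_fps (\<lambda>k. complete_homogeneous k 0 x)) k = fps_nth (1::'a fps) k"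
      by (cases k) (simp_all add: complete_homogeneous_no_vars)
  qed
  then show ?case by simp
next
  case (Suc n)
  have "Abs_fps (\<lambda>k. complete_homogeneous k (Suc n) x) * (1 - fps_const (x (Suc n)) * fps_X) =
      Abs_fps (\<lambda>k. complete_homogeneous k n x)" (is "?H * _ = ?H'")
  proof (rule fps_ext)
    fix k
    have "?H * (1 - fps_const (x (Suc n)) * fps_X) = ?H - fps_const (x (Suc n)) * (fps_X * ?H)"
      by (simp add: algebra_simps)
    then show "fps_nth (?H * (1 - fps_const (x (Suc n)) * fps_X)) k = fps_nth ?H' k"
      by (cases k) (simp_all add: complete_homogeneous_Suc)
  qed
  moreover have "(\<Prod>i=1..Suc n. 1 - fps_const (x i) * fps_X) =
      (1 - fps_const (x (Suc n)) * fps_X) * (\<Prod>i=1..n. 1 - fps_const (x i) * fps_X)"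
    by (simp add: mult.commute)
  ultimately have "?H * (\<Prod>i=1..Suc n. 1 - fps_const (x i) * fps_X) =
      ?H' * (\<Prod>i=1..n. 1 - fps_const (x i) * fps_X)"
    by (simp only: mult.assoc[symmetric])
  then show ?case by (simp only: Suc)
qed

text \<open>Both sides are polynomials of degree at most \<open>m\<close> that agree at
  \<open>m + 1\<close> points: both are 1 at 0, and both vanish at the \<open>m\<close> distinct
  inverses of powers of \<open>w\<close>.\<close>

lemma prod_one_minus_roots_of_unity:
  fixes w :: complex
  assumes m: "m > 0" and w: "w ^ m = 1" and prim: "\<And>j. \<lbrakk>0 < j; j < m\<rbrakk> \<Longrightarrow> w ^ j \<noteq> 1"
  shows "(\<Prod>i<m. 1 - fps_const (w ^ i) * fps_X) = (1 - fps_X ^ m :: complex fps)"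
proof -
  have w0: "w \<noteq> 0" using m w by (auto simp: power_0_left)
  have inj: "inj_on (\<lambda>i. inverse (w ^ i)) {..<m}"
  proof (rule linorder_inj_onI')
    fix i j assume ij: "i \<in> {..<m}" "j \<in> {..<m}" "i < j"
    have "w ^ j = w ^ i * w ^ (j - i)" using ij by (simp flip: power_add)
    then show "inverse (w ^ i) \<noteq> inverse (w ^ j)" using prim[of "j - i"] ij w0 by auto
  qed
  define A where "A = insert 0 ((\<lambda>i. inverse (w ^ i)) ` {..<m})"
  have eq: "(\<Prod>i<m. [:1, - (w ^ i):]) = 1 - Polynomial.monom 1 m" (is "?P = ?Q")
  proof (rule poly_eqI_degree[where A = A])
    have "card A = Suc m"
      unfolding A_def by (subst card_insert_disjoint) (auto simp: card_image[OF inj] w0)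
    moreover have "degree ?P \<le> m"
      using degree_prod_sum_le[of "{..<m}" "\<lambda>i. [:1, - (w ^ i):]"] w0 by simp
    moreover have "degree ?Q \<le> m"
      by (intro degree_diff_le) (auto intro: degree_monom_le)
    ultimately show "degree ?P < card A" "degree ?Q < card A" by simp_all
    fix z assume "z \<in> A"
    then consider "z = 0" | i where "i < m" "z = inverse (w ^ i)" by (auto simp: A_def)
    then show "poly ?P z = poly ?Q z"
    proof cases
      case 1
      then show ?thesis using m by (simp add: poly_prod poly_monom)
    next
      case 2
      have "z ^ m = inverse ((w ^ m) ^ i)"
        by (simp add: 2 power_inverse mult.commute flip: power_mult)
      then have "poly ?Q z = 0" using w by (simp add: poly_monom)
      moreover have "poly ?P z = 0" using 2 w0 by (auto simp: poly_prod intro!: bexI[of _ i])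
      ultimately show ?thesis by simp
    qed
  qed
  have "fps_of_poly [:1, - (w ^ i):] = 1 - fps_const (w ^ i) * fps_X" for i
    by (simp add: fps_of_poly_pCons mult.commute)
  then have "(\<Prod>i<m. 1 - fps_const (w ^ i) * fps_X) = fps_of_poly ?P"
    unfolding fps_of_poly_prod by (intro prod.cong) simp_all
  also have "\<dots> = 1 - fps_X ^ m"
    by (simp add: eq fps_of_poly_diff fps_of_poly_monom')
  finally show ?thesis .
qed

text \<open>The binomial series of the inverse of \<open>(1 - X^m)^g\<close>. By Pascal's rule a
  factor \<open>1 - X^m\<close> lowers \<open>g\<close> by one.\<close>

lemma fps_multichoose_dilated:
  assumes m: "m > 0"
  shows "Abs_fps (\<lambda>k. if m dvd k then of_nat ((g + k div m - 1) choose (k div m)) else 0) *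
           (1 - fps_X ^ m) ^ g = (1 :: 'a::comm_ring_1 fps)"
proof (induction g)
  case 0
  \<comment> \<open>For \<open>g = 0\<close> and \<open>k = m * j\<close> the coefficient is
    \<open>(j - 1) choose j\<close> with truncated subtraction: 1 at \<open>j = 0\<close> and 0 at
    every later \<open>j\<close>.\<close>
  show ?case
    using m by (auto simp: fps_eq_iff binomial_eq_0 elim!: dvdE)
next
  case (Suc g)
  define H :: "nat \<Rightarrow> 'a fps" where
    "H g = Abs_fps (\<lambda>k. if m dvd k then of_nat ((g + k div m - 1) choose (k div m)) else 0)" for g
  have "H (Suc g) * (1 - fps_X ^ m) = H g"
  proof (rule fps_ext)
    fix k
    have *: "fps_nth (H (Suc g) * (1 - fps_X ^ m)) k = fps_nth (H (Suc g)) k - (if k < m then 0 else fps_nth (H (Suc g)) (k - m))"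
      by (simp add: right_diff_distrib fps_X_power_mult_right_nth)
    show "fps_nth (H (Suc g) * (1 - fps_X ^ m)) k = fps_nth (H g) k"
    proof (cases "m dvd k")
      case True
      then obtain j where k: "k = m * j" by auto
      show ?thesis
      proof (cases j)
        case 0
        then show ?thesis using m unfolding * by (simp add: H_def k)
      next
        case (Suc j')
        then have "k - m = m * j'" "\<not> k < m" by (simp_all add: k)
        then show ?thesis using m Suc unfolding * by (simp add: H_def k algebra_simps)
      qed
    next
      case False
      then have "\<not> k < m \<Longrightarrow> \<not> m dvd (k - m)" by (simp add: dvd_minus_self)
      then show ?thesis using False unfolding * by (simp add: H_def)
    qed
  qed
  then have "H (Suc g) * (1 - fps_X ^ m) ^ Suc g = H g * (1 - fps_X ^ m) ^ g"
    unfolding power_Suc mult.assoc[symmetric] by (rule arg_cong)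
  then show ?case
    using Suc unfolding H_def by (rule trans)
qed

text \<open>The exponents \<open>i - 1\<close> run through \<open>g\<close> full blocks of residues
  modulo \<open>m\<close>, so the denominator of the generating function is
  \<open>(1 - X^m)^g\<close>.\<close>

lemma complete_homogeneous_roots_of_unity:
  fixes w :: complex
  assumes m: "m > 0" and w: "w ^ m = 1" and prim: "\<And>j. \<lbrakk>0 < j; j < m\<rbrakk> \<Longrightarrow> w ^ j \<noteq> 1"
  shows "complete_homogeneous k (g * m) (\<lambda>i. w ^ (i - 1)) =
           (if m dvd k then of_nat ((g + k div m - 1) choose (k div m)) else 0)"
proof -
  let ?H = "Abs_fps (\<lambda>k. complete_homogeneous k (g * m) (\<lambda>i. w ^ (i - 1)))"
  let ?C = "Abs_fps (\<lambda>k. if m dvd k then of_nat ((g + k div m - 1) choose (k div m)) else 0) :: complex fps"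
  let ?f = "\<lambda>i. 1 - fps_const (w ^ i) * fps_X"
  have shift: "w ^ (j * m + i) = w ^ i" for i j
    using w by (simp add: power_add mult.commute[of j] power_mult)
  have "(\<Prod>i=1..g*m. 1 - fps_const (w ^ (i - 1)) * fps_X) = (\<Prod>i<g*m. ?f i)"
    by (rule prod.reindex_bij_witness[where i = Suc and j = "\<lambda>i. i - 1"]) auto
  also have "\<dots> = (\<Prod>j<g. prod ?f {j * m..<j * m + m})"
    by (rule prod.nat_group[symmetric])
  also have "\<dots> = (\<Prod>j<g. \<Prod>i<m. ?f i)"
  proof (rule prod.cong)
    fix j
    have "prod ?f {j * m..<j * m + m} = (\<Prod>i<m. ?f (j * m + i))"
      by (rule prod.reindex_bij_witness[where i = "\<lambda>i. j * m + i" and j = "\<lambda>i. i - j * m"]) auto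
    then show "prod ?f {j * m..<j * m + m} = (\<Prod>i<m. ?f i)" by (simp add: shift)
  qed simp
  also have "\<dots> = (1 - fps_X ^ m) ^ g"
    by (simp add: prod_one_minus_roots_of_unity[OF assms])
  finally have H: "?H * (1 - fps_X ^ m) ^ g = 1"
    using fps_complete_homogeneous[of "g * m" "\<lambda>i. w ^ (i - 1)"] by simp
  have C: "?C * (1 - fps_X ^ m) ^ g = 1"
    by (rule fps_multichoose_dilated[OF m])
  \<comment> \<open>Two inverses of the same series coincide.\<close>
  have "?H = ?H * (?C * (1 - fps_X ^ m) ^ g)"
    by (simp only: C mult_1_right)
  also have "\<dots> = ?C * (?H * (1 - fps_X ^ m) ^ g)"
    by (rule mult.left_commute)
  also have "\<dots> = ?C"
    by (simp only: H mult_1_right)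
  finally have "?H = ?C" .
  then have "fps_nth ?H k = fps_nth ?C k" by simp
  then show ?thesis by simp
qed

section \<open>Counting periodic functions with a prescribed sum\<close>

lemma sum_int_lessThan: "(\<Sum>a\<in>{0..<int n}. f a) = (\<Sum>i<n. f (int i))"
  by (rule sum.reindex_bij_witness[where i = int and j = nat]) auto

lemma sum_periodic_blocks:
  fixes s :: "int \<Rightarrow> nat"
  assumes "periodic (int g) s"
  shows "(\<Sum>a\<in>{0..<int (g * m)}. s a) = m * (\<Sum>i<g. s (int i))"
proof -
  have "(\<Sum>a\<in>{0..<int (g * m)}. s a) = (\<Sum>j<m. sum (\<lambda>i. s (int i)) {j * g..<j * g + g})"
    unfolding sum_int_lessThan by (simp add: sum.nat_group mult.commute)
  also have "\<dots> = (\<Sum>j<m. \<Sum>i<g. s (int i))"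
  proof (rule sum.cong)
    fix j
    have "sum (\<lambda>i. s (int i)) {j * g..<j * g + g} = (\<Sum>i<g. s (int i + int g * int j))"
      by (rule sum.reindex_bij_witness[where i = "\<lambda>i. j * g + i" and j = "\<lambda>i. i - j * g"])
         (auto simp: algebra_simps)
    then show "sum (\<lambda>i. s (int i)) {j * g..<j * g + g} = (\<Sum>i<g. s (int i))"
      by (simp add: periodic_multiple[OF assms])
  qed simp
  finally show ?thesis by simp
qed

text \<open>The values on one period of length \<open>g\<close> form a list, whose sum is repeated
  \<open>m\<close> times over the long period. This reduces the count to stars and bars.\<close>

lemma bij_betw_periodic_lists:
  assumes g: "g > 0" and m: "m > 0"
  shows "bij_betw (\<lambda>s. map (\<lambda>i. s (int i)) [0..<g])
           {s :: int \<Rightarrow> nat. periodic (int g) s \<and> (\<Sum>a\<in>{0..<int (g * m)}. s a) = m * k}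
           {xs. length xs = g \<and> sum_list xs = k}"
proof (rule bij_betw_byWitness[where f' = "\<lambda>xs a. xs ! nat (a mod int g)"])
  show "\<forall>s\<in>{s :: int \<Rightarrow> nat. periodic (int g) s \<and> (\<Sum>a\<in>{0..<int (g * m)}. s a) = m * k}.
      (\<lambda>a. map (\<lambda>i. s (int i)) [0..<g] ! nat (a mod int g)) = s"
    using g by (auto simp: fun_eq_iff nat_less_iff periodic_mod)
  show "\<forall>xs\<in>{xs. length xs = g \<and> sum_list xs = k}.
      map (\<lambda>i. xs ! nat (int i mod int g)) [0..<g] = xs"
    by (auto intro!: nth_equalityI)
  show "(\<lambda>s. map (\<lambda>i. s (int i)) [0..<g]) `
      {s. periodic (int g) s \<and> (\<Sum>a\<in>{0..<int (g * m)}. s a) = m * k}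
      \<subseteq> {xs. length xs = g \<and> sum_list xs = k}"
    using m by (auto simp: sum_periodic_blocks interv_sum_list_conv_sum_set_nat atLeast0LessThan
        simp del: of_nat_mult)
  have "periodic (int g) (\<lambda>a. xs ! nat (a mod int g))" for xs :: "nat list"
    by (simp add: periodic_def)
  then show "(\<lambda>xs a. xs ! nat (a mod int g)) ` {xs. length xs = g \<and> sum_list xs = k}
      \<subseteq> {s. periodic (int g) s \<and> (\<Sum>a\<in>{0..<int (g * m)}. s a) = m * k}"
    by (auto simp: sum_periodic_blocks sum_list_sum_nth atLeast0LessThan simp del: of_nat_mult)
qed

lemma card_periodic_sum:
  assumes g: "g > 0" and m: "m > 0"
  shows "card {s :: int \<Rightarrow> nat. periodic (int g) s \<and> (\<Sum>a\<in>{0..<int (g * m)}. s a) = k} =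
           (if m dvd k then (g + k div m - 1) choose (k div m) else 0)"
proof (cases "m dvd k")
  case True
  then show ?thesis
    using bij_betw_same_card[OF bij_betw_periodic_lists[OF g m, of "k div m"]]
    by (simp add: card_length_sum_list add.commute)
next
  case False
  then have "{s :: int \<Rightarrow> nat. periodic (int g) s \<and> (\<Sum>a\<in>{0..<int (g * m)}. s a) = k} = {}"
    by (auto simp: sum_periodic_blocks simp del: of_nat_mult)
  then show ?thesis using False by (simp only: card.empty if_False)
qed

lemma finite_periodic_sum:
  assumes n: "n > 0"
  shows "finite {s :: int \<Rightarrow> nat. periodic (int n) s \<and> (\<Sum>a\<in>{0..<int n}. s a) = k}"
proof -
  \<comment> \<open>An infinite set has \<open>card\<close> 0, so a positive count proves
    finiteness.\<close>
  have "(n + k - 1) choose k > 0" using n by simp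
  then show ?thesis
    using card_periodic_sum[of n 1 k] n by (intro card_ge_0_finite) simp
qed

text \<open>With \<open>g = gcd n d\<close> the doubly periodic functions are the
  \<open>g\<close>-periodic ones, and \<open>\<zeta> ^ d\<close> has order
  \<open>m = n div g\<close>. Both sides then equal the same binomial coefficient, or 0 if
  \<open>m\<close> does not divide \<open>k\<close>.\<close>

lemma card_periodic_sum_roots_of_unity:
  fixes \<zeta> :: complex
  assumes n: "n > 0" and \<zeta>: "has_mult_order \<zeta> n"
  shows "of_nat (card {s :: int \<Rightarrow> nat. periodic (int n) s \<and> periodic (int d) s \<and> (\<Sum>a\<in>{0..<int n}. s a) = k}) =
           complete_homogeneous k n (\<lambda>i. (\<zeta> ^ d) ^ (i - 1))"
proof -
  define g where "g = gcd n d"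
  define m where "m = n div g"
  have g: "g > 0" and n_eq: "n = g * m" using n by (simp_all add: g_def m_def)
  then have m: "m > 0" using n by (cases m) auto
  have one_iff: "\<zeta> ^ j = 1 \<longleftrightarrow> n dvd j" for j
  proof
    assume *: "\<zeta> ^ j = 1"
    have "\<zeta> ^ j = (\<zeta> ^ n) ^ (j div n) * \<zeta> ^ (j mod n)"
      by (simp flip: power_mult power_add)
    then have "\<zeta> ^ (j mod n) = 1" using * \<zeta> by (simp add: has_mult_order_def)
    then have "j mod n = 0" using \<zeta> n by (metis has_mult_order_def mod_less_divisor neq0_conv)
    then show "n dvd j" by auto
  qed (use \<zeta> in \<open>auto simp: has_mult_order_def power_mult elim!: dvdE\<close>)
  obtain e where e: "d = g * e" using g_def by (metis gcd_dvd2 dvdE)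
  \<comment> \<open>Cancel \<open>g\<close> in \<open>gcd (g * m) (g * e) = g\<close>.\<close>
  have cop: "coprime m e"
    using gcd_mult_distrib_nat[of g m e] g by (simp add: g_def[symmetric] flip: n_eq e) (simp add: coprime_iff_gcd_eq_1)
  have w: "(\<zeta> ^ d) ^ j = 1 \<longleftrightarrow> m dvd j" for j
  proof -
    have "(\<zeta> ^ d) ^ j = 1 \<longleftrightarrow> g * m dvd g * (e * j)"
      unfolding power_mult[symmetric] one_iff by (simp add: n_eq e mult.assoc)
    also have "\<dots> \<longleftrightarrow> m dvd j"
      using g cop by (simp add: coprime_dvd_mult_right_iff)
    finally show ?thesis .
  qed
  have "periodic (int n) s \<and> periodic (int d) s \<longleftrightarrow> periodic (int g) s" for s :: "int \<Rightarrow> nat"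
    using periodic_gcd[of "int n" s "int d"] periodic_dvd[of "int g" "int n" s] periodic_dvd[of "int g" "int d" s]
    by (auto simp: g_def)
  then have "{s :: int \<Rightarrow> nat. periodic (int n) s \<and> periodic (int d) s \<and> (\<Sum>a\<in>{0..<int n}. s a) = k}
      = {s. periodic (int g) s \<and> (\<Sum>a\<in>{0..<int (g * m)}. s a) = k}"
    unfolding n_eq[symmetric] by blast
  then have "card {s :: int \<Rightarrow> nat. periodic (int n) s \<and> periodic (int d) s \<and> (\<Sum>a\<in>{0..<int n}. s a) = k}
      = (if m dvd k then (g + k div m - 1) choose (k div m) else 0)"
    by (simp only: card_periodic_sum[OF g m])
  moreover have "(\<zeta> ^ d) ^ m = 1" "\<And>j. \<lbrakk>0 < j; j < m\<rbrakk> \<Longrightarrow> (\<zeta> ^ d) ^ j \<noteq> 1"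
    unfolding w by (auto dest: dvd_imp_le)
  from complete_homogeneous_roots_of_unity[OF m this, of k g]
  have "complete_homogeneous k n (\<lambda>i. (\<zeta> ^ d) ^ (i - 1)) =
      (if m dvd k then of_nat ((g + k div m - 1) choose (k div m)) else 0)"
    by (simp only: n_eq)
  ultimately show ?thesis by simp
qed

text \<open>Supplies the hypotheses of \<open>complete_homogeneous_hom\<close> for evaluating a
  natural polynomial at a complex number. Multiplicativity follows from additivity by induction on
  the first factor.\<close>

lemma poly_nat_eval_hom:
  fixes z :: complex
  defines "\<phi> \<equiv> \<lambda>p :: nat poly. poly (map_poly of_nat p) z"
  shows "\<phi> 0 = 0" "\<phi> 1 = 1" "\<phi> (p + q) = \<phi> p + \<phi> q" "\<phi> (p * q) = \<phi> p * \<phi> q"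
proof -
  show add: "\<phi> (p + q) = \<phi> p + \<phi> q" for p q
  proof -
    have "map_poly of_nat (p + q) = (map_poly of_nat p + map_poly of_nat q :: complex poly)"
      by (rule poly_eqI) (simp add: coeff_map_poly)
    then show ?thesis by (simp add: \<phi>_def)
  qed
  show "\<phi> (p * q) = \<phi> p * \<phi> q"
  proof (induction p)
    case (pCons a p)
    have "\<phi> (pCons a p * q) = \<phi> (Polynomial.smult a q) + \<phi> (pCons 0 (p * q))"
      by (simp add: add)
    also have "\<dots> = of_nat a * \<phi> q + z * \<phi> (p * q)"
      by (simp add: \<phi>_def map_poly_smult map_poly_pCons)
    also have "\<dots> = \<phi> (pCons a p) * \<phi> q"
      by (simp add: pCons.IH) (simp add: \<phi>_def map_poly_pCons algebra_simps)
    finally show ?case .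
  qed (simp add: \<phi>_def)
qed (simp_all add: \<phi>_def)

section \<open>C-edges as arcs\<close>

text \<open>Twice the signed area of the triangle.\<close>

definition side :: "complex \<Rightarrow> complex \<Rightarrow> complex \<Rightarrow> real" where
  "side p q r = (Re q - Re p) * (Im r - Im p) - (Im q - Im p) * (Re r - Re p)"

lemma side_affine: "side p q ((1 - u) *\<^sub>R r + u *\<^sub>R s) = (1 - u) * side p q r + u * side p q s"
  by (simp add: side_def algebra_simps)

lemma side_endpoints [simp]: "side p q p = 0" "side p q q = 0"
  by (simp_all add: side_def)

text \<open>The area of an inscribed triangle factors into sines of half angles, so the orientation
  of points on the circle can be read off from their angles.\<close>

lemma side_cis:
  "side (cis \<alpha>) (cis \<beta>) (cis \<gamma>) =
     4 * sin ((\<beta> - \<alpha>) / 2) * sin ((\<gamma> - \<beta>) / 2) * sin ((\<gamma> - \<alpha>) / 2)"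
proof -
  define u v where "u = (\<beta> - \<alpha>) / 2" and "v = (\<gamma> - \<beta>) / 2"
  have "side (cis \<alpha>) (cis \<beta>) (cis \<gamma>) = sin (\<beta> - \<alpha>) + sin (\<gamma> - \<beta>) - sin (\<gamma> - \<alpha>)"
    by (simp add: side_def sin_diff algebra_simps)
  also have "\<dots> = sin (2 * u) + sin (2 * v) - sin (2 * u + 2 * v)"
  proof -
    have "2 * u = \<beta> - \<alpha>" "2 * v = \<gamma> - \<beta>" by (simp_all add: u_def v_def)
    then show ?thesis by simp
  qed
  also have "\<dots> = sin (2 * u) * (1 - cos (2 * v)) + sin (2 * v) * (1 - cos (2 * u))"
    by (simp add: sin_add algebra_simps)
  also have "\<dots> = 4 * sin u * sin v * (sin u * cos v + cos u * sin v)"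
    unfolding sin_double cos_double_sin by (simp add: power2_eq_square algebra_simps)
  also have "\<dots> = 4 * sin u * sin v * sin (u + v)"
    by (simp add: sin_add)
  also have "u + v = (\<gamma> - \<alpha>) / 2"
    by (simp add: u_def v_def field_simps)
  finally show ?thesis by (simp add: u_def v_def)
qed

text \<open>A common point has \<open>side\<close> 0 because it lies on the first segment. On the
  second one it is a combination, with positive weights, of two values of the same weak sign that
  are not both 0.\<close>

lemma open_segments_disjoint:
  assumes "side p q r * side p q s \<ge> 0" "side p q r \<noteq> 0 \<or> side p q s \<noteq> 0"
  shows "open_segment p q \<inter> open_segment r s = {}"
proof (rule ccontr)
  assume "\<not> ?thesis"
  then obtain z where z: "z \<in> open_segment p q" "z \<in> open_segment r s" by blast
  from z(1) have "side p q z = 0" by (auto simp: in_segment side_affine)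
  moreover from z(2) obtain u where u: "0 < u" "u < 1" "z = (1 - u) *\<^sub>R r + u *\<^sub>R s"
    by (auto simp: in_segment)
  ultimately have *: "(1 - u) * side p q r + u * side p q s = 0"
    by (simp add: side_affine)
  from assms(1) consider "side p q r \<ge> 0" "side p q s \<ge> 0" | "side p q r \<le> 0" "side p q s \<le> 0"
    by (auto simp: zero_le_mult_iff)
  then show False
  proof cases
    case 1
    then have "(1 - u) * side p q r \<ge> 0" "u * side p q s \<ge> 0" using u by auto
    then have "(1 - u) * side p q r = 0" "u * side p q s = 0" using * by linarith+
    then show False using u assms(2) by auto
  next
    case 2
    then have "(1 - u) * side p q r \<le> 0" "u * side p q s \<le> 0"
      using u by (auto simp: mult_nonneg_nonpos)
    then have "(1 - u) * side p q r = 0" "u * side p q s = 0" using * by linarith+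
    then show False using u assms(2) by auto
  qed
qed

text \<open>
  The areas of the four triangles give the affine dependency of the vertices of a convex
  quadrilateral, and with it the intersection point of the diagonals.
\<close>

lemma diagonals_intersect:
  assumes pos: "side p q r > 0" "side q r s > 0" "side r s p > 0" "side s p q > 0"
    and neq: "p \<noteq> r" "q \<noteq> s"
  shows "open_segment p r \<inter> open_segment q s \<noteq> {}"
proof -
  \<comment> \<open>Twice the area of the quadrilateral, cut along either diagonal; \<open>u\<close>
    and \<open>v\<close> below are the positions of the intersection point on the two
    diagonals.\<close>
  define N where "N = side q r s + side s p q"
  have N: "N > 0" "N = side r s p + side p q r"
    using pos by (simp_all add: N_def) (simp add: side_def algebra_simps)
  define u v where "u = side s p q / N" and "v = side p q r / N"
  have u: "0 < u" "u < 1" "1 - u = side q r s / N"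
    using pos N by (auto simp: u_def N_def field_simps)
  have v: "0 < v" "v < 1" "1 - v = side r s p / N"
    using pos N by (auto simp: v_def field_simps)
  have "side q r s * Re p + side s p q * Re r = side r s p * Re q + side p q r * Re s"
    and "side q r s * Im p + side s p q * Im r = side r s p * Im q + side p q r * Im s"
    by (simp_all add: side_def algebra_simps)
  then have "(1 - u) *\<^sub>R p + u *\<^sub>R r = (1 - v) *\<^sub>R q + v *\<^sub>R s"
    unfolding u(3) v(3) using N(1)
    by (simp add: complex_eq_iff u_def v_def flip: add_divide_distrib)
  moreover have "(1 - u) *\<^sub>R p + u *\<^sub>R r \<in> open_segment p r"
    using u(1,2) neq(1) unfolding in_segment by blast
  moreover have "(1 - v) *\<^sub>R q + v *\<^sub>R s \<in> open_segment q s"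
    using v(1,2) neq(2) unfolding in_segment by blast
  ultimately show ?thesis by auto
qed

section \<open>Vertices and chords indexed by arbitrary integers\<close>

definition vertex :: "nat \<Rightarrow> int \<Rightarrow> complex" where
  "vertex n a = cis (pi * real_of_int a / real n)"

definition chord :: "nat \<Rightarrow> int \<Rightarrow> int \<Rightarrow> complex set" where
  "chord n a b = closed_segment (vertex n a) (vertex n b)"

lemma vertex_add: "vertex n (a + b) = cis (pi * real_of_int b / real n) * vertex n a"
  by (simp add: vertex_def cis_mult ring_distribs add_divide_distrib add.commute)

lemma vertex_eq_iff:
  assumes "n > 0"
  shows "vertex n a = vertex n b \<longleftrightarrow> 2 * int n dvd a - b"
proof -
  have "vertex n a = vertex n b \<longleftrightarrow>
      (\<exists>i::int. pi * real_of_int a / real n = pi * real_of_int b / real n + 2 * pi * real_of_int i)"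
    unfolding sin_cos_eq_iff[symmetric] by (auto simp: vertex_def complex_eq_iff)
  also have "\<dots> \<longleftrightarrow> (\<exists>i::int. real_of_int a = real_of_int (b + 2 * int n * i))"
  proof (intro iff_exI)
    fix i :: int
    have "pi * real_of_int b / real n + 2 * pi * real_of_int i =
        pi * real_of_int (b + 2 * int n * i) / real n"
      using assms by (simp add: field_simps)
    then show "pi * real_of_int a / real n = pi * real_of_int b / real n + 2 * pi * real_of_int i \<longleftrightarrow>
        real_of_int a = real_of_int (b + 2 * int n * i)"
      using assms by simp
  qed
  also have "\<dots> \<longleftrightarrow> 2 * int n dvd a - b"
    unfolding of_int_eq_iff by (auto simp: dvd_def algebra_simps)
  finally show ?thesis .
qed

lemma vertex_shift: "n > 0 \<Longrightarrow> vertex n (a + 2 * int n * i) = vertex n a"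
  by (simp add: vertex_eq_iff)

lemma vertex_antipode: "n > 0 \<Longrightarrow> vertex n (a + int n) = - vertex n a"
  by (simp add: vertex_add)

lemma chord_shift: "n > 0 \<Longrightarrow> chord n (a + 2 * int n * i) (b + 2 * int n * i) = chord n a b"
  by (simp add: chord_def vertex_shift)

lemma chord_commute: "chord n a b = chord n b a"
  by (simp add: chord_def closed_segment_commute)

lemma chord_image_mult:
  "(\<lambda>z. cis (pi * real_of_int c / real n) * z) ` chord n a b = chord n (a + c) (b + c)"
  unfolding chord_def vertex_add
  by (rule closed_segment_linear_image[symmetric]) (simp add: bounded_linear.linear bounded_linear_mult_right)

lemma chord_image_uminus: "n > 0 \<Longrightarrow> uminus ` chord n a b = chord n (a + int n) (b + int n)"
  unfolding chord_def vertex_antipode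
  by (rule closed_segment_linear_image[symmetric]) (simp add: linear_uminus)

lemma chord_eq_iff:
  assumes "n > 0"
  shows "chord n a b = chord n c d \<longleftrightarrow>
    (2 * int n dvd a - c \<and> 2 * int n dvd b - d) \<or> (2 * int n dvd a - d \<and> 2 * int n dvd b - c)"
  by (simp add: chord_def doubleton_eq_iff vertex_eq_iff[OF assms])

lemma not_dvd_between:
  fixes m x :: int
  assumes "0 < x" "x < m"
  shows "\<not> m dvd x" "\<not> m dvd - x"
  using assms zdvd_not_zless by auto

text \<open>The bounds keep the endpoints distinct; the relative interior of a one-point segment
  would be that point.\<close>

lemma rel_interior_chord:
  assumes "n > 0" "a < b" "b < a + 2 * int n"
  shows "rel_interior (chord n a b) = open_segment (vertex n a) (vertex n b)"
  using not_dvd_between[of "b - a" "2 * int n"] assms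
  by (simp add: chord_def rel_interior_closed_segment vertex_eq_iff)

lemma sin_half_pos:
  assumes "n > 0" "a < b" "b < a + 2 * int n"
  shows "sin ((pi * real_of_int b / real n - pi * real_of_int a / real n) / 2) > 0"
proof -
  define x where "x = real_of_int (b - a) / (2 * real n)"
  have "real_of_int b < real_of_int a + 2 * real n" using assms by linarith
  then have "0 < x" "x < 1" using assms by (simp_all add: x_def)
  moreover have "(pi * real_of_int b / real n - pi * real_of_int a / real n) / 2 = pi * x"
    by (simp add: x_def right_diff_distrib diff_divide_distrib)
  ultimately show ?thesis by (simp add: sin_gt_zero)
qed

lemma side_vertex_pos:
  assumes "n > 0" "a < b" "b < c" "c < a + 2 * int n"
  shows "side (vertex n a) (vertex n b) (vertex n c) > 0"
  unfolding vertex_def side_cis using assms by (intro mult_pos_pos sin_half_pos) auto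

lemma side_vertex_neg:
  assumes "n > 0" "a < c" "c < b" "b < a + 2 * int n"
  shows "side (vertex n a) (vertex n b) (vertex n c) < 0"
proof -
  have "side (vertex n a) (vertex n b) (vertex n c) = - side (vertex n a) (vertex n c) (vertex n b)"
    by (simp add: side_def algebra_simps)
  then show ?thesis using side_vertex_pos[of n a c b] assms by simp
qed

text \<open>The vertices at \<open>a\<close>, \<open>c\<close>, \<open>b\<close>, \<open>d\<close>
  are met in this order within one turn, so they form a convex quadrilateral with the two chords as
  diagonals.\<close>

lemma chords_cross:
  assumes "n > 0" "a < c" "c < b" "b < d" "d < a + 2 * int n"
  shows "edges_cross (chord n a b) (chord n c d)"
proof -
  have "chord n a b \<noteq> chord n c d"
    using not_dvd_between[of "c - a" "2 * int n"] not_dvd_between[of "d - a" "2 * int n"] assms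
    by (auto simp: chord_eq_iff)
  moreover have "open_segment (vertex n a) (vertex n b) \<inter> open_segment (vertex n c) (vertex n d) \<noteq> {}"
  proof (rule diagonals_intersect)
    \<comment> \<open>Moving \<open>a\<close> and \<open>c\<close> forward by a full turn puts the
      indices of each of the four triangles in increasing order.\<close>
    have a: "vertex n a = vertex n (a + 2 * int n)" and c: "vertex n c = vertex n (c + 2 * int n)"
      using vertex_shift[of n _ 1] assms by simp_all
    show "side (vertex n a) (vertex n c) (vertex n b) > 0" "side (vertex n c) (vertex n b) (vertex n d) > 0"
      by (intro side_vertex_pos; use assms in simp)+
    show "side (vertex n b) (vertex n d) (vertex n a) > 0"
      unfolding a by (intro side_vertex_pos) (use assms in simp_all)
    show "side (vertex n d) (vertex n a) (vertex n c) > 0"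
      unfolding a c by (intro side_vertex_pos) (use assms in simp_all)
    show "vertex n a \<noteq> vertex n b" "vertex n c \<noteq> vertex n d"
      using not_dvd_between[of "b - a" "2 * int n"] not_dvd_between[of "d - c" "2 * int n"] assms
      by (simp_all add: vertex_eq_iff)
  qed
  ultimately show ?thesis
    using assms by (simp add: edges_cross_def rel_interior_chord)
qed

text \<open>Contrapositive: if no shift of the second chord by full turns interlaces with the first,
  its endpoints lie weakly on one side of the first chord and not both on it, so
  \<open>open_segments_disjoint\<close> applies.\<close>

lemma chords_cross_imp:
  assumes n: "n > 0" and ab: "a < b" "b < a + 2 * int n" and cd: "c < d" "d < c + 2 * int n"
    and cross: "edges_cross (chord n a b) (chord n c d)"
  shows "\<exists>t. (a < c + 2 * int n * t \<and> c + 2 * int n * t < b \<and> b < d + 2 * int n * t) \<or>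
             (c + 2 * int n * t < a \<and> a < d + 2 * int n * t \<and> d + 2 * int n * t < b)"
proof (rule ccontr)
  assume no: "\<not> ?thesis"
  \<comment> \<open>This shift moves \<open>c\<close> to its representative \<open>c'\<close> in the
    turn that begins at \<open>a\<close>.\<close>
  define t where "t = - ((c - a) div (2 * int n))"
  define c' d' where "c' = c + 2 * int n * t" and "d' = d + 2 * int n * t"
  have "c' = a + (c - a) mod (2 * int n)"
    by (simp add: c'_def t_def minus_div_mult_eq_mod[symmetric] algebra_simps)
  then have c': "a \<le> c'" "c' < a + 2 * int n"
    using n by simp_all
  have d': "c' < d'" "d' < c' + 2 * int n" using cd by (simp_all add: c'_def d'_def)
  \<comment> \<open>The position of a vertex relative to the first chord: negative strictly between
    \<open>a\<close> and \<open>b\<close>, positive strictly between \<open>b\<close> and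
    \<open>a + 2 * int n\<close>, 0 at the endpoints.\<close>
  define f where "f x = side (vertex n a) (vertex n b) (vertex n x)" for x
  have neg: "f x < 0" if "a < x" "x < b" for x
    unfolding f_def using side_vertex_neg n ab that by blast
  have pos: "f x > 0" if "b < x" "x < a + 2 * int n" for x
    unfolding f_def using side_vertex_pos n ab that by blast
  have shift: "f (x - 2 * int n) = f x" for x
    using vertex_shift[OF n, of x "-1"] by (simp add: f_def)
  have zero: "f a = 0" "f b = 0" "f (a + 2 * int n) = 0"
    using shift[of "a + 2 * int n"] by (simp_all add: f_def)
  have cross': "edges_cross (chord n a b) (chord n c' d')"
    using cross chord_shift[OF n] by (simp add: c'_def d'_def)
  then have "chord n a b \<noteq> chord n c' d'" by (simp add: edges_cross_def)
  then have neq: "\<not> (c' = a \<and> d' = b)" "\<not> (c' = b \<and> d' = a + 2 * int n)"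
    using n by (auto simp: chord_eq_iff)
  have "f c' * f d' \<ge> 0 \<and> (f c' \<noteq> 0 \<or> f d' \<noteq> 0)"
  proof -
    consider "c' = a" | "a < c'" "c' < b" | "b \<le> c'" using c' by linarith
    then show ?thesis
    proof cases
      case 1
      then have "d' < b \<or> b < d'" using neq by auto
      then have "f d' \<noteq> 0" using neg[of d'] pos[of d'] d' 1 by auto
      then show ?thesis using 1 zero by simp
    next
      case 2
      then have "d' \<le> b" using no unfolding c'_def d'_def by (meson not_le)
      then have "f d' \<le> 0" using neg[of d'] zero d' c' by (cases "d' = b") auto
      then show ?thesis using neg[of c'] 2 by (simp add: mult_nonpos_nonpos)
    next
      case 3
      \<comment> \<open>Here \<open>c'\<close> lies on the far arc. One turn back it lies before
        \<open>a\<close>, so \<open>d'\<close> moved back by a turn cannot lie strictly between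
        \<open>a\<close> and \<open>b\<close>.\<close>
      have "\<not> (c + 2 * int n * (t - 1) < a \<and> a < d + 2 * int n * (t - 1) \<and> d + 2 * int n * (t - 1) < b)"
        using no by blast
      moreover have "c + 2 * int n * (t - 1) = c' - 2 * int n" "d + 2 * int n * (t - 1) = d' - 2 * int n"
        by (simp_all add: c'_def d'_def algebra_simps)
      ultimately consider "d' \<le> a + 2 * int n" | "b \<le> d' - 2 * int n"
        using c' by force
      then show ?thesis
      proof cases
        case 4: 1
        have "f c' \<ge> 0" "c' = b \<or> f c' > 0"
          using pos[of c'] 3 c' zero by (cases "c' = b"; auto)+
        moreover have "f d' \<ge> 0" "d' = a + 2 * int n \<or> f d' > 0"
          using pos[of d'] 3 d' 4 zero by (cases "d' = a + 2 * int n"; auto)+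
        ultimately show ?thesis using neq by auto
      next
        case 5: 2
        have "f c' > 0" using pos[of c'] 5 d' c' by auto
        moreover have "f d' \<ge> 0"
          using pos[of "d' - 2 * int n"] shift[of d'] zero 5 d' c' by (cases "b = d' - 2 * int n") auto
        ultimately show ?thesis by simp
      qed
    qed
  qed
  then have "open_segment (vertex n a) (vertex n b) \<inter> open_segment (vertex n c') (vertex n d') = {}"
    unfolding f_def by (intro open_segments_disjoint) auto
  then show False
    using cross' n ab d' by (simp add: edges_cross_def rel_interior_chord)
qed

text \<open>Taking all shifts by multiples of \<open>n\<close> makes the antipodal pair periodic by
  construction and covers diameters, where the pair collapses to one chord, without a case
  distinction.\<close>

definition c_arc :: "nat \<Rightarrow> int \<Rightarrow> nat \<Rightarrow> complex set set" where
  "c_arc n a l = range (\<lambda>s. chord n (a + int n * s) (a + int l + int n * s))"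

lemma periodic_c_arc: "periodic (int n) (\<lambda>a. c_arc n a l)"
  unfolding periodic_def
proof
  fix a
  have "c_arc n (a + int n) l = (\<lambda>s. chord n (a + int n * s) (a + int l + int n * s)) ` range (\<lambda>s. s + 1)"
    unfolding c_arc_def image_image by (rule image_cong) (simp_all add: algebra_simps)
  also have "range (\<lambda>s::int. s + 1) = UNIV"
    by (metis surj_def diff_add_cancel)
  finally show "c_arc n (a + int n) l = c_arc n a l"
    by (simp add: c_arc_def)
qed

text \<open>Only the parity of the shift matters, since two half turns restore the chord.\<close>

lemma c_arc_eq_insert:
  assumes "n > 0"
  shows "c_arc n a l = {chord n a (a + int l), uminus ` chord n a (a + int l)}"
proof -
  have "chord n (a + int n * s) (a + int l + int n * s) =
      (if even s then chord n a (a + int l) else chord n (a + int n) (a + int l + int n))" for s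
  proof (cases "even s")
    case True
    then obtain r where "s = 2 * r" by auto
    then show ?thesis using chord_shift[OF assms, of a r "a + int l"] by (simp add: mult_ac)
  next
    case False
    then obtain r where "s = 2 * r + 1" by (elim oddE)
    then show ?thesis
      using chord_shift[OF assms, of "a + int n" r "a + int l + int n"] by (simp add: algebra_simps)
  qed
  then have "c_arc n a l =
      (\<lambda>s. if even s then chord n a (a + int l) else chord n (a + int n) (a + int l + int n)) ` (UNIV :: int set)"
    by (simp add: c_arc_def)
  also have "\<dots> = {chord n a (a + int l), chord n (a + int n) (a + int l + int n)}"
  proof -
    have "(\<lambda>s::int. if even s then x else y) ` UNIV = {x, y}" for x y :: "complex set"
    proof
      show "{x, y} \<subseteq> (\<lambda>s::int. if even s then x else y) ` UNIV"
        using rangeI[of "\<lambda>s::int. if even s then x else y" 0] rangeI[of "\<lambda>s::int. if even s then x else y" 1]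
        by auto
    qed auto
    then show ?thesis .
  qed
  finally show ?thesis using assms by (simp add: chord_image_uminus)
qed

text \<open>Equal chords have equal or interchanged endpoints. Interchange makes
  \<open>int l + int l'\<close> a multiple of \<open>2 * int n\<close>, which for lengths at most
  \<open>n\<close> leaves only diameters, and the endpoints of a diameter are congruent modulo
  \<open>n\<close>.\<close>

lemma c_arc_eq_iff:
  assumes l: "l \<in> {1..n}" "l' \<in> {1..n}"
  shows "c_arc n a l = c_arc n c l' \<longleftrightarrow> int n dvd a - c \<and> l = l'"
proof
  assume eq: "c_arc n a l = c_arc n c l'"
  have n: "n > 0" using l by auto
  have "chord n a (a + int l) \<in> c_arc n c l'" unfolding eq[symmetric] by (subst c_arc_eq_insert[OF n]) simp
  then obtain s where "chord n a (a + int l) = chord n (c + int n * s) (c + int l' + int n * s)"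
    by (auto simp: c_arc_def)
  then consider
      i j where "a - (c + int n * s) = 2 * int n * i" "a + int l - (c + int l' + int n * s) = 2 * int n * j"
    | i j where "a - (c + int l' + int n * s) = 2 * int n * i" "a + int l - (c + int n * s) = 2 * int n * j"
    unfolding chord_eq_iff[OF n] by (auto elim!: dvdE)
  then show "int n dvd a - c \<and> l = l'"
  proof cases
    case 1
    then have "int l - int l' = 2 * int n * (j - i)" by (simp add: algebra_simps)
    then have "2 * int n dvd int l - int l'" by simp
    moreover have "\<bar>int l - int l'\<bar> < 2 * int n" using l by auto
    ultimately have "l = l'" using zdvd_imp_le[of "2 * int n" "\<bar>int l - int l'\<bar>"] by fastforce
    moreover have "a - c = int n * (s + 2 * i)" using 1 by (simp add: algebra_simps)
    ultimately show ?thesis by simp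
  next
    case 2
    then have "int l + int l' = 2 * int n * (j - i)" by (simp add: algebra_simps)
    then have "2 * int n dvd int l + int l'" by simp
    then have "2 * int n \<le> int l + int l'" using l by (intro zdvd_imp_le) auto
    then have "l = n" "l' = n" using l by auto
    moreover have "a - c = int n * (s + 2 * i + 1)" using 2 \<open>l' = n\<close> by (simp add: algebra_simps)
    ultimately show ?thesis by simp
  qed
next
  assume "int n dvd a - c \<and> l = l'"
  then obtain i where "a = c + int n * i" "l = l'" by (metis dvdE add.commute diff_add_cancel)
  then show "c_arc n a l = c_arc n c l'"
    using periodic_multiple[OF periodic_c_arc] by simp
qed

lemma c_edges_eq_c_arcs:
  assumes n: "n > 0"
  shows "c_edges n = {c_arc n a l | a l. l \<in> {1..n}}"
proof (intro equalityI subsetI)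
  have vs: "polygon_vertices n = {vertex n (int i) | i. i < 2 * n}"
    by (simp add: polygon_vertices_def vertex_def)
  have "diameters n \<subseteq> polygon_edges n"
  proof
    fix e assume "e \<in> diameters n"
    then obtain a where a: "e = closed_segment a (- a)" "a \<in> polygon_vertices n"
      by (auto simp: diameters_def)
    then obtain i where i: "a = vertex n (int i)" by (auto simp: vs)
    have "- a = vertex n ((int i + int n) mod (2 * int n))"
      using n by (simp add: i vertex_eq_iff mod_eq_dvd_iff[symmetric] flip: vertex_antipode)
    also have "(int i + int n) mod (2 * int n) = int ((i + n) mod (2 * n))"
      by (simp add: zmod_int)
    finally have "- a \<in> polygon_vertices n" using n by (auto simp: vs intro!: exI[of _ "(i + n) mod (2 * n)"])
    moreover have "a \<noteq> - a"
      by (simp add: i vertex_def)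
    ultimately show "e \<in> polygon_edges n" using a unfolding polygon_edges_def by blast
  qed
  note sub = this
  \<comment> \<open>A diameter is its own antipode, so both kinds of C-edges take the form of an
    edge together with its image under \<open>uminus\<close>.\<close>
  have sym: "{e} = {e, uminus ` e}" if "e \<in> diameters n" for e
  proof -
    from that obtain a where "e = closed_segment a (- a)" by (auto simp: diameters_def)
    moreover have "uminus ` closed_segment a (- a) = closed_segment (- a) (- (- a))"
      by (rule closed_segment_linear_image[symmetric]) (simp add: linear_uminus)
    ultimately show ?thesis by (simp add: closed_segment_commute)
  qed
  have ce: "E \<in> c_edges n \<longleftrightarrow> (\<exists>e\<in>polygon_edges n. E = {e, uminus ` e})" for E
  proof
    assume "E \<in> c_edges n"
    then consider e where "E = {e, uminus ` e}" "e \<in> polygon_edges n" | e where "E = {e}" "e \<in> diameters n"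
      unfolding c_edges_def by auto
    then show "\<exists>e\<in>polygon_edges n. E = {e, uminus ` e}"
    proof cases
      case 1
      then show ?thesis by (intro bexI[of _ e])
    next
      case 2
      then show ?thesis using sub sym[of e] by (intro bexI[of _ e]) (auto simp only: subsetD)
    qed
  next
    assume "\<exists>e\<in>polygon_edges n. E = {e, uminus ` e}"
    then obtain e where e: "e \<in> polygon_edges n" "E = {e, uminus ` e}" by auto
    show "E \<in> c_edges n"
    proof (cases "e \<in> diameters n")
      case True
      then have "E = {e}" using e(2) sym by metis
      then show ?thesis using True unfolding c_edges_def by blast
    next
      case False
      then show ?thesis using e unfolding c_edges_def by blast
    qed
  qed
  {
    fix E assume "E \<in> c_edges n"
    then obtain i j where ij: "i < 2 * n" "j < 2 * n" "vertex n (int i) \<noteq> vertex n (int j)"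
        "E = {chord n (int i) (int j), uminus ` chord n (int i) (int j)}"
      unfolding ce by (auto simp: polygon_edges_def vs chord_def)
    have "\<exists>i j :: int. 0 \<le> i \<and> i < j \<and> j < 2 * int n \<and> E = {chord n i j, uminus ` chord n i j}"
    proof (cases "i < j")
      case True
      then show ?thesis using ij by (intro exI[of _ "int i"] exI[of _ "int j"]) auto
    next
      case False
      then have "j < i" using ij(3) by (cases "i = j") auto
      then show ?thesis
        using ij chord_commute[of n "int i" "int j"] by (intro exI[of _ "int j"] exI[of _ "int i"]) auto
    qed
    then obtain i j :: int where ij: "0 \<le> i" "i < j" "j < 2 * int n"
        "E = {chord n i j, uminus ` chord n i j}" by blast
    show "E \<in> {c_arc n a l | a l. l \<in> {1..n}}"
    proof (cases "j - i \<le> int n")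
      case True
      then have "E = c_arc n i (nat (j - i))" "nat (j - i) \<in> {1..n}"
        using ij n by (auto simp: c_arc_eq_insert)
      then show ?thesis by blast
    next
      case False
      \<comment> \<open>The arc from \<open>i\<close> to \<open>j\<close> is longer than a half
        turn; the complementary arc from \<open>j\<close> onwards to \<open>i\<close> spans the same
        chord.\<close>
      define l where "l = nat (2 * int n - (j - i))"
      have "l \<in> {1..n}" "j + int l = i + 2 * int n * 1" using False ij by (auto simp: l_def)
      moreover have "chord n j (j + int l) = chord n i j"
        using vertex_shift[OF n, of i 1] calculation(2) by (simp add: chord_def closed_segment_commute)
      ultimately have "E = c_arc n j l" "l \<in> {1..n}"
        using ij n by (simp_all add: c_arc_eq_insert)
      then show ?thesis by blast
    qed
  }
  {
    fix E assume "E \<in> {c_arc n a l | a l. l \<in> {1..n}}"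
    then obtain a l where E: "E = c_arc n a l" and l: "l \<in> {1..n}" by auto
    have v: "vertex n b \<in> polygon_vertices n" for b
    proof -
      have "vertex n b = vertex n (int (nat (b mod (2 * int n))))"
        using n by (simp add: vertex_eq_iff mod_eq_dvd_iff[symmetric])
      then show ?thesis using n unfolding vs by (auto simp: nat_less_iff intro!: exI[of _ "nat (b mod (2 * int n))"])
    qed
    have "vertex n a \<noteq> vertex n (a + int l)"
      using n l not_dvd_between[of "int l" "2 * int n"] by (simp add: vertex_eq_iff)
    then have "chord n a (a + int l) \<in> polygon_edges n"
      using v by (auto simp: polygon_edges_def chord_def)
    then show "E \<in> c_edges n"
      unfolding ce E c_arc_eq_insert[OF n] by blast
  }
qed

lemma c_arcs_cross:
  assumes l: "l \<in> {1..n}" "l' \<in> {1..n}" and "a < c" "c < a + int l" "a + int l < c + int l'"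
  shows "c_edges_cross (c_arc n a l) (c_arc n c l')"
proof -
  have "n > 0" using l by auto
  then have "edges_cross (chord n a (a + int l)) (chord n c (c + int l'))"
    using assms by (intro chords_cross) auto
  then show ?thesis
    unfolding c_edges_cross_def using \<open>n > 0\<close> by (auto simp: c_arc_eq_insert)
qed

text \<open>Crossing members of the two C-edges are shifts of the base arcs by multiples of
  \<open>n\<close>. Together with a shift by full turns they combine into a single shift of
  \<open>c\<close>.\<close>

lemma c_arcs_cross_imp:
  assumes l: "l \<in> {1..n}" "l' \<in> {1..n}" and cross: "c_edges_cross (c_arc n a l) (c_arc n c l')"
  shows "\<exists>t. (a < c + int n * t \<and> c + int n * t < a + int l \<and> a + int l < c + int n * t + int l') \<or>
             (c + int n * t < a \<and> a < c + int n * t + int l' \<and> c + int n * t + int l' < a + int l)"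
proof -
  have n: "n > 0" using l by auto
  obtain s s' where "edges_cross (chord n (a + int n * s) (a + int l + int n * s))
      (chord n (c + int n * s') (c + int l' + int n * s'))"
    using cross by (auto simp: c_edges_cross_def c_arc_def)
  from chords_cross_imp[OF n _ _ _ _ this] l obtain t where
    "(a + int n * s < c + int n * s' + 2 * int n * t \<and>
      c + int n * s' + 2 * int n * t < a + int l + int n * s \<and>
      a + int l + int n * s < c + int l' + int n * s' + 2 * int n * t) \<or>
     (c + int n * s' + 2 * int n * t < a + int n * s \<and>
      a + int n * s < c + int l' + int n * s' + 2 * int n * t \<and>
      c + int l' + int n * s' + 2 * int n * t < a + int l + int n * s)"
    by auto
  then show ?thesis
    by (intro exI[of _ "s' - s + 2 * t"]) (simp add: algebra_simps)
qed

lemma rotate_c_arc: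
  "rotate_c_edge (- (2 * pi / real (2 * n))) (c_arc n a l) = c_arc n (a - 1) l"
proof -
  have "- (2 * pi / real (2 * n)) = pi * real_of_int (- 1) / real n"
    by simp
  then show ?thesis
    unfolding rotate_c_edge_def c_arc_def image_image
    by (simp only: chord_image_mult) (simp add: algebra_simps)
qed

section \<open>Multidissections and pairs of multisets\<close>

lemma c_arc_in_c_edges: "l \<in> {1..n} \<Longrightarrow> c_arc n a l \<in> c_edges n"
  using c_edges_eq_c_arcs[of n] by auto

lemma c_edges_cases:
  assumes "n > 0" "E \<in> c_edges n"
  obtains a l where "E = c_arc n a l" "l \<in> {1..n}"
  using assms c_edges_eq_c_arcs by auto

text \<open>Turns sums over all C-edges into sums over starting points and lengths.\<close>

lemma bij_betw_c_arc:
  assumes n: "n > 0"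
  shows "bij_betw (\<lambda>(a, l). c_arc n a l) ({0..<int n} \<times> {1..n}) (c_edges n)"
  unfolding bij_betw_def
proof
  show "inj_on (\<lambda>(a, l). c_arc n a l) ({0..<int n} \<times> {1..n})"
  proof (rule inj_onI, clarify)
    fix a b l l'
    assume *: "a \<in> {0..<int n}" "b \<in> {0..<int n}" "l \<in> {1..n}" "l' \<in> {1..n}"
      "c_arc n a l = c_arc n b l'"
    then have "int n dvd a - b \<and> l = l'" using c_arc_eq_iff by blast
    then have "a mod int n = b mod int n" "l = l'" by (simp_all add: mod_eq_dvd_iff)
    then show "a = b \<and> l = l'" using * by simp
  qed
  show "(\<lambda>(a, l). c_arc n a l) ` ({0..<int n} \<times> {1..n}) = c_edges n"
  proof
    show "(\<lambda>(a, l). c_arc n a l) ` ({0..<int n} \<times> {1..n}) \<subseteq> c_edges n"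
      by (auto intro: c_arc_in_c_edges)
    show "c_edges n \<subseteq> (\<lambda>(a, l). c_arc n a l) ` ({0..<int n} \<times> {1..n})"
    proof
      fix E assume "E \<in> c_edges n"
      then obtain a l where E: "E = c_arc n a l" "l \<in> {1..n}"
        by (rule c_edges_cases[OF n])
      then have "E = c_arc n (a mod int n) l" using periodic_mod[OF periodic_c_arc] by metis
      then show "E \<in> (\<lambda>(a, l). c_arc n a l) ` ({0..<int n} \<times> {1..n})"
        using E(2) n by (intro image_eqI[of _ _ "(a mod int n, l)"]) auto
    qed
  qed
qed

section \<open>The two multisets attached to a multidissection\<close>

definition starts :: "nat \<Rightarrow> (complex set set \<Rightarrow> nat) \<Rightarrow> int \<Rightarrow> nat" where
  "starts n f a = (\<Sum>l=1..n. f (c_arc n a l))"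

definition ends :: "nat \<Rightarrow> (complex set set \<Rightarrow> nat) \<Rightarrow> int \<Rightarrow> nat" where
  "ends n f b = (\<Sum>l=1..n. f (c_arc n (b - int l) l))"

lemma periodic_starts: "periodic (int n) (starts n f)"
  by (simp add: periodic_def starts_def periodicD[OF periodic_c_arc])

lemma periodic_ends: "periodic (int n) (ends n f)"
proof -
  have "c_arc n (b + int n - int l) l = c_arc n (b - int l) l" for b l
    using periodicD[OF periodic_c_arc[of n l], of "b - int l"] by (simp add: algebra_simps)
  then show ?thesis by (simp add: periodic_def ends_def)
qed

lemma sum_ends: "(\<Sum>b\<in>{0..<int n}. ends n f b) = (\<Sum>a\<in>{0..<int n}. starts n f a)"
  unfolding ends_def starts_def
  by (rule sum_starts_eq_sum_ends) (simp add: periodic_def periodicD[OF periodic_c_arc])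

text \<open>Replaces crossing in the plane by interlacing on the integer line. A crossing of C-edges
  lifts to interlacing arcs after a shift by a multiple of \<open>n\<close>, and exchanging the arcs
  reduces the two orders of interlacing to one.\<close>

lemma mem_c_multidissections_iff:
  assumes n: "n > 0"
  shows "f \<in> c_multidissections n k \<longleftrightarrow> f \<in> extensional (c_edges n) \<and>
    (\<forall>a c l l'. l \<in> {1..n} \<longrightarrow> l' \<in> {1..n} \<longrightarrow> a < c \<longrightarrow> c < a + int l \<longrightarrow> a + int l < c + int l' \<longrightarrow>
       f (c_arc n a l) = 0 \<or> f (c_arc n c l') = 0) \<and>
    (\<Sum>a\<in>{0..<int n}. starts n f a) = k"
    (is "_ \<longleftrightarrow> _ \<and> ?nc \<and> _")
proof -
  have "(\<Sum>E\<in>c_edges n. f E) = (\<Sum>(a, l)\<in>{0..<int n} \<times> {1..n}. f (c_arc n a l))"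
    using sum.reindex_bij_betw[OF bij_betw_c_arc[OF n], of f] by (simp add: case_prod_unfold)
  also have "\<dots> = (\<Sum>a\<in>{0..<int n}. starts n f a)"
    unfolding starts_def by (rule sum.cartesian_product[symmetric])
  finally have sum: "(\<Sum>E\<in>c_edges n. f E) = (\<Sum>a\<in>{0..<int n}. starts n f a)" .
  have "(\<forall>E\<in>c_edges n. \<forall>E'\<in>c_edges n. c_edges_cross E E' \<longrightarrow> f E = 0 \<or> f E' = 0) \<longleftrightarrow> ?nc"
    (is "?nc' \<longleftrightarrow> _")
  proof
    assume nc: ?nc'
    show ?nc
    proof (intro allI impI)
      fix a c l l'
      assume *: "l \<in> {1..n}" "l' \<in> {1..n}" "a < c" "c < a + int l" "a + int l < c + int l'"
      show "f (c_arc n a l) = 0 \<or> f (c_arc n c l') = 0"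
        by (rule nc[rule_format, OF c_arc_in_c_edges[OF *(1)] c_arc_in_c_edges[OF *(2)] c_arcs_cross[OF *]])
    qed
  next
    assume nc: ?nc
    show ?nc'
    proof (intro ballI impI)
      fix E E' assume E: "E \<in> c_edges n" "E' \<in> c_edges n" and cross: "c_edges_cross E E'"
      from E(1) obtain a l where a: "E = c_arc n a l" "l \<in> {1..n}" by (rule c_edges_cases[OF n])
      from E(2) obtain c l' where c: "E' = c_arc n c l'" "l' \<in> {1..n}" by (rule c_edges_cases[OF n])
      note eq = a(1) c(1) and l = a(2) c(2)
      have per: "c_arc n (c + int n * t) l' = E'" for t
        unfolding eq by (rule periodic_multiple[OF periodic_c_arc])
      from c_arcs_cross_imp[OF l cross[unfolded eq]] obtain t where
        "(a < c + int n * t \<and> c + int n * t < a + int l \<and> a + int l < c + int n * t + int l') \<or>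
         (c + int n * t < a \<and> a < c + int n * t + int l' \<and> c + int n * t + int l' < a + int l)"
        by blast
      then show "f E = 0 \<or> f E' = 0"
      proof (elim disjE conjE)
        assume "a < c + int n * t" "c + int n * t < a + int l" "a + int l < c + int n * t + int l'"
        from nc[rule_format, OF l this] show ?thesis by (simp only: per a(1))
      next
        assume "c + int n * t < a" "a < c + int n * t + int l'" "c + int n * t + int l' < a + int l"
        from nc[rule_format, OF l(2,1) this] show ?thesis by (simp only: per a(1) disj_commute)
      qed
    qed
  qed
  then show ?thesis
    unfolding c_multidissections_def sum[symmetric] by (simp add: PiE_UNIV_domain PiE_def)
qed

lemma c_multidissection_noncrossing:
  assumes "n > 0" "f \<in> c_multidissections n k"
    and "l \<in> {1..n}" "l' \<in> {1..n}" "a < c" "c < a + int l" "a + int l < c + int l'"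
  shows "f (c_arc n a l) = 0 \<or> f (c_arc n c l') = 0"
  using mem_c_multidissections_iff[OF assms(1), THEN iffD1, OF assms(2), THEN conjunct2, THEN conjunct1,
      rule_format, OF assms(3-)] .

lemma c_multidissection_eqI:
  assumes n: "n > 0" and f: "f \<in> c_multidissections n k" and g: "g \<in> c_multidissections n k'"
    and eq: "\<And>a. starts n f a = starts n g a" "\<And>b. ends n f b = ends n g b"
  shows "f = g"
proof (rule extensionalityI)
  show "f \<in> extensional (c_edges n)" "g \<in> extensional (c_edges n)"
    using f g by (simp_all add: mem_c_multidissections_iff[OF n])
  fix E assume "E \<in> c_edges n"
  then obtain a l where E: "E = c_arc n a l" "l \<in> {1..n}"
    by (rule c_edges_cases[OF n])
  have "f (c_arc n a l) = g (c_arc n a l)"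
  proof (rule noncrossing_determined[where F = "\<lambda>a l. f (c_arc n a l)" and G = "\<lambda>a l. g (c_arc n a l)"])
    show "f (c_arc n a l) = 0 \<or> f (c_arc n c l') = 0"
      if "l \<in> {1..n}" "l' \<in> {1..n}" "a < c" "c < a + int l" "a + int l < c + int l'" for a c l l'
      using that by (rule c_multidissection_noncrossing[OF n f])
    show "g (c_arc n a l) = 0 \<or> g (c_arc n c l') = 0"
      if "l \<in> {1..n}" "l' \<in> {1..n}" "a < c" "c < a + int l" "a + int l < c + int l'" for a c l l'
      using that by (rule c_multidissection_noncrossing[OF n g])
    show "(\<Sum>j=1..n. f (c_arc n a j)) = (\<Sum>j=1..n. g (c_arc n a j))" for a
      using eq(1)[of a] by (simp only: starts_def)
    show "(\<Sum>j=1..n. f (c_arc n (b - int j) j)) = (\<Sum>j=1..n. g (c_arc n (b - int j) j))" for b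
      using eq(2)[of b] by (simp only: ends_def)
  qed (rule E(2))
  then show "f E = g E" by (simp add: E)
qed

lemma ex_c_multidissection:
  assumes n: "n > 0" and s: "periodic (int n) s" "(\<Sum>a\<in>{0..<int n}. s a) = k"
    and t: "periodic (int n) t" "(\<Sum>a\<in>{0..<int n}. t a) = k"
  shows "\<exists>f\<in>c_multidissections n k. starts n f = s \<and> ends n f = t"
proof -
  \<comment> \<open>Chooses a start and a length for each C-edge. The start is unique only modulo
    \<open>n\<close>, which suffices because the greedy matching is periodic.\<close>
  define p where "p E = (SOME (a, l). l \<in> {1..n} \<and> E = c_arc n a l)" for E
  define f where "f = restrict (\<lambda>E. greedy_matching s t (fst (p E)) (snd (p E))) (c_edges n)"
  have f: "f (c_arc n a l) = greedy_matching s t a l" if l: "l \<in> {1..n}" for a l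
  proof -
    obtain b j where p: "p (c_arc n a l) = (b, j)" by fastforce
    have "case p (c_arc n a l) of (b, j) \<Rightarrow> j \<in> {1..n} \<and> c_arc n a l = c_arc n b j"
      unfolding p_def by (rule someI[of _ "(a, l)"]) (use l in simp)
    then have "j \<in> {1..n}" "c_arc n a l = c_arc n b j" by (simp_all add: p)
    then have "int n dvd a - b" "j = l" using l by (auto simp: c_arc_eq_iff)
    then have "a mod int n = b mod int n" by (simp add: mod_eq_dvd_iff)
    then have "greedy_matching s t b l = greedy_matching s t a l"
      using periodic_mod[OF periodic_greedy_matching[OF s(1) t(1)]] by metis
    then show ?thesis
      using c_arc_in_c_edges[OF l] by (simp add: f_def p \<open>j = l\<close>)
  qed
  have perfect: "(\<Sum>j=1..n. greedy_matching s t a j) = s a"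
      "(\<Sum>j=1..n. greedy_matching s t (b - int j) j) = t b" for a b
    using greedy_matching_perfect[OF s(1) t(1)] s(2) t(2) n by auto
  have st: "starts n f a = s a" "ends n f b = t b" for a b
  proof -
    have "starts n f a = (\<Sum>j=1..n. greedy_matching s t a j)"
      unfolding starts_def by (rule sum.cong) (simp_all only: f)
    then show "starts n f a = s a" by (simp only: perfect)
    have "ends n f b = (\<Sum>j=1..n. greedy_matching s t (b - int j) j)"
      unfolding ends_def by (rule sum.cong) (simp_all only: f)
    then show "ends n f b = t b" by (simp only: perfect)
  qed
  have "f \<in> c_multidissections n k"
    unfolding mem_c_multidissections_iff[OF n]
  proof (intro conjI allI impI)
    show "f \<in> extensional (c_edges n)" by (simp add: f_def)
    show "(\<Sum>a\<in>{0..<int n}. starts n f a) = k" by (simp add: st s(2))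
    fix a c l l'
    assume "l \<in> {1..n}" "l' \<in> {1..n}" "a < c" "c < a + int l" "a + int l < c + int l'"
    then show "f (c_arc n a l) = 0 \<or> f (c_arc n c l') = 0"
      using greedy_matching_noncrossing[of l l' a c s t] by (simp add: f)
  qed
  then show ?thesis using st by blast
qed

lemma bij_betw_starts_ends:
  fixes n k :: nat
  assumes n: "n > 0"
  defines "W \<equiv> {s :: int \<Rightarrow> nat. periodic (int n) s \<and> (\<Sum>a\<in>{0..<int n}. s a) = k}"
  shows "bij_betw (\<lambda>f. (starts n f, ends n f)) (c_multidissections n k) (W \<times> W)"
  unfolding bij_betw_def
proof
  show "inj_on (\<lambda>f. (starts n f, ends n f)) (c_multidissections n k)"
    using c_multidissection_eqI[OF n] by (intro inj_onI) auto
  show "(\<lambda>f. (starts n f, ends n f)) ` c_multidissections n k = W \<times> W"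
  proof
    show "(\<lambda>f. (starts n f, ends n f)) ` c_multidissections n k \<subseteq> W \<times> W"
      by (auto simp: W_def periodic_starts periodic_ends sum_ends mem_c_multidissections_iff[OF n])
    show "W \<times> W \<subseteq> (\<lambda>f. (starts n f, ends n f)) ` c_multidissections n k"
      using ex_c_multidissection[OF n] by (fastforce simp: W_def image_iff)
  qed
qed

lemma finite_c_multidissections: "n > 0 \<Longrightarrow> finite (c_multidissections n k)"
  using bij_betw_finite[OF bij_betw_starts_ends] finite_periodic_sum by blast

section \<open>Rotation as translation of both multisets\<close>

lemma rotate_multidissection_c_arc:
  assumes "l \<in> {1..n}"
  shows "rotate_multidissection n f (c_arc n a l) = f (c_arc n (a - 1) l)"
  unfolding rotate_multidissection_def
  by (simp only: restrict_apply' c_arc_in_c_edges[OF assms] rotate_c_arc)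

lemma starts_rotate: "starts n (rotate_multidissection n f) a = starts n f (a - 1)"
  unfolding starts_def by (intro sum.cong) (simp_all add: rotate_multidissection_c_arc)

lemma ends_rotate: "ends n (rotate_multidissection n f) b = ends n f (b - 1)"
  unfolding ends_def by (intro sum.cong) (simp_all add: rotate_multidissection_c_arc algebra_simps)

lemma starts_rotate_pow: "starts n ((rotate_multidissection n ^^ d) f) a = starts n f (a - int d)"
  by (induction d arbitrary: a) (simp_all add: starts_rotate algebra_simps)

lemma ends_rotate_pow: "ends n ((rotate_multidissection n ^^ d) f) b = ends n f (b - int d)"
  by (induction d arbitrary: b) (simp_all add: ends_rotate algebra_simps)

lemma rotate_in_c_multidissections:
  assumes n: "n > 0" and f: "f \<in> c_multidissections n k"
  shows "rotate_multidissection n f \<in> c_multidissections n k"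
  unfolding mem_c_multidissections_iff[OF n]
proof (intro conjI allI impI)
  show "rotate_multidissection n f \<in> extensional (c_edges n)"
    by (simp add: rotate_multidissection_def)
  show "(\<Sum>a\<in>{0..<int n}. starts n (rotate_multidissection n f) a) = k"
    using sum_periodic_shift[OF periodic_starts, of n f "-1"] f
    by (simp add: starts_rotate mem_c_multidissections_iff[OF n])
  fix a c l l'
  assume "l \<in> {1..n}" "l' \<in> {1..n}" "a < c" "c < a + int l" "a + int l < c + int l'"
  then show "rotate_multidissection n f (c_arc n a l) = 0 \<or> rotate_multidissection n f (c_arc n c l') = 0"
    using c_multidissection_noncrossing[OF n f, of l l' "a - 1" "c - 1"]
    by (simp add: rotate_multidissection_c_arc)
qed

lemma rotate_pow_in_c_multidissections:
  assumes "n > 0" "f \<in> c_multidissections n k"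
  shows "(rotate_multidissection n ^^ d) f \<in> c_multidissections n k"
  using assms by (induction d) (simp_all add: rotate_in_c_multidissections)

text \<open>Starting and end points determine a multidissection, and both are
  \<open>n\<close>-periodic. This is why the rotations give an action of the cyclic group of order
  \<open>n\<close>.\<close>

lemma rotate_pow_cong:
  assumes n: "n > 0" and f: "f \<in> c_multidissections n k" and eq: "int p mod int n = int q mod int n"
  shows "(rotate_multidissection n ^^ p) f = (rotate_multidissection n ^^ q) f"
proof -
  have "(a - int p) mod int n = (a - int q) mod int n" for a
    using eq by (metis mod_diff_right_eq)
  then have "g (a - int p) = g (a - int q)" if "periodic (int n) g" for a and g :: "int \<Rightarrow> nat"
    using periodic_mod[OF that] by metis
  then show ?thesis
    by (intro c_multidissection_eqI[OF n rotate_pow_in_c_multidissections[OF n f]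
          rotate_pow_in_c_multidissections[OF n f]])
       (simp_all add: starts_rotate_pow ends_rotate_pow periodic_starts periodic_ends)
qed

lemma rotate_pow_fixed_iff:
  assumes n: "n > 0" and f: "f \<in> c_multidissections n k"
  shows "(rotate_multidissection n ^^ d) f = f \<longleftrightarrow>
    periodic (int d) (starts n f) \<and> periodic (int d) (ends n f)"
proof
  assume "(rotate_multidissection n ^^ d) f = f"
  then have "starts n f a = starts n f (a - int d)" "ends n f a = ends n f (a - int d)" for a
    using starts_rotate_pow[of n d f a] ends_rotate_pow[of n d f a] by simp_all
  from this(1)[of "a + int d" for a] this(2)[of "a + int d" for a]
  show "periodic (int d) (starts n f) \<and> periodic (int d) (ends n f)"
    by (simp add: periodic_def)
next
  assume *: "periodic (int d) (starts n f) \<and> periodic (int d) (ends n f)"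
  show "(rotate_multidissection n ^^ d) f = f"
  proof (rule c_multidissection_eqI[OF n rotate_pow_in_c_multidissections[OF n f] f])
    show "starts n ((rotate_multidissection n ^^ d) f) a = starts n f a" for a
      using * periodicD[of "int d" "starts n f" "a - int d"] by (simp add: starts_rotate_pow)
    show "ends n ((rotate_multidissection n ^^ d) f) a = ends n f a" for a
      using * periodicD[of "int d" "ends n f" "a - int d"] by (simp add: ends_rotate_pow)
  qed
qed

text \<open>The bijection with pairs of multisets restricts to fixed points, where the two
  components are invariant independently of each other. Hence a square, to match the two factors of
  \<open>h_(k,k)\<close>.\<close>

lemma card_rotation_fixed:
  assumes n: "n > 0"
  shows "card {f \<in> c_multidissections n k. (rotate_multidissection n ^^ d) f = f} =
    (card {s :: int \<Rightarrow> nat. periodic (int n) s \<and> periodic (int d) s \<and> (\<Sum>a\<in>{0..<int n}. s a) = k})\<^sup>2"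
proof -
  let ?\<Phi> = "\<lambda>f. (starts n f, ends n f)"
  let ?W = "{s :: int \<Rightarrow> nat. periodic (int n) s \<and> (\<Sum>a\<in>{0..<int n}. s a) = k}"
  let ?V = "{s :: int \<Rightarrow> nat. periodic (int n) s \<and> periodic (int d) s \<and> (\<Sum>a\<in>{0..<int n}. s a) = k}"
  let ?F = "{f \<in> c_multidissections n k. (rotate_multidissection n ^^ d) f = f}"
  have F: "?F = {f \<in> c_multidissections n k. ?\<Phi> f \<in> ?V \<times> ?V}"
    using rotate_pow_fixed_iff[OF n] bij_betw_apply[OF bij_betw_starts_ends[OF n, of k]] by auto
  have bij: "bij_betw ?\<Phi> ?F (?\<Phi> ` ?F)"
    using bij_betw_starts_ends[OF n, of k] by (rule bij_betw_subset) auto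
  have image: "?\<Phi> ` ?F = ?V \<times> ?V"
  proof
    show "?\<Phi> ` ?F \<subseteq> ?V \<times> ?V" unfolding F by blast
    show "?V \<times> ?V \<subseteq> ?\<Phi> ` ?F"
    proof
      fix x assume x: "x \<in> ?V \<times> ?V"
      then have "x \<in> ?W \<times> ?W" by auto
      then obtain f where "f \<in> c_multidissections n k" "x = ?\<Phi> f"
        using bij_betw_imp_surj_on[OF bij_betw_starts_ends[OF n, of k]] by blast
      then show "x \<in> ?\<Phi> ` ?F" using x unfolding F by blast
    qed
  qed
  have "card ?F = card (?V \<times> ?V)"
    using bij unfolding image by (rule bij_betw_same_card)
  then show ?thesis by (simp add: card_cartesian_product power2_eq_square)
qed

lemma group_action_rotation:
  assumes n: "n > 0"
  shows "group_action (integer_mod_group n) (c_multidissections n k) (rotation_action n k)"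
proof -
  let ?X = "c_multidissections n k" and ?r = "rotate_multidissection n"
  have in_Bij: "rotation_action n k j \<in> Bij ?X" for j
  proof -
    define p where "p = nat j"
    \<comment> \<open>\<open>p * (n - 1)\<close> further steps undo \<open>p\<close> steps, as
      together they make \<open>p * n\<close> steps.\<close>
    have inv: "(?r ^^ (p * (n - 1))) ((?r ^^ p) f) = f" "(?r ^^ p) ((?r ^^ (p * (n - 1))) f) = f"
      if f: "f \<in> ?X" for f
    proof -
      have "p * (n - 1) + p = p * n" using n by (cases n) simp_all
      then have "(?r ^^ (p * (n - 1) + p)) f = (?r ^^ 0) f" "(?r ^^ (p + p * (n - 1))) f = (?r ^^ 0) f"
        by (intro rotate_pow_cong[OF n f]; simp add: add.commute)+
      then show "(?r ^^ (p * (n - 1))) ((?r ^^ p) f) = f" "(?r ^^ p) ((?r ^^ (p * (n - 1))) f) = f"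
        by (simp_all add: funpow_add)
    qed
    have "bij_betw (?r ^^ p) ?X ?X"
      by (rule bij_betw_byWitness[where f' = "?r ^^ (p * (n - 1))"])
         (use inv rotate_pow_in_c_multidissections[OF n] in auto)
    then have "bij_betw (rotation_action n k j) ?X ?X"
      unfolding rotation_action_def p_def by (rule bij_betw_cong[THEN iffD1, rotated]) simp
    then show ?thesis by (simp add: Bij_def rotation_action_def)
  qed
  \<comment> \<open>Group elements are representatives in \<open>{0..<int n}\<close>; their
    nonnegativity makes \<open>nat\<close> additive on them.\<close>
  have "rotation_action n k ((i + j) mod int n) =
      compose ?X (rotation_action n k i) (rotation_action n k j)"
    if ij: "0 \<le> i" "0 \<le> j" for i j
  proof
    fix f
    show "rotation_action n k ((i + j) mod int n) f =
        compose ?X (rotation_action n k i) (rotation_action n k j) f"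
    proof (cases "f \<in> ?X")
      case True
      then have "(?r ^^ nat ((i + j) mod int n)) f = (?r ^^ (nat i + nat j)) f"
        using ij n by (intro rotate_pow_cong[OF n True]) simp
      then show ?thesis
        using True rotate_pow_in_c_multidissections[OF n True]
        by (simp add: rotation_action_def compose_def funpow_add)
    next
      case False
      then show ?thesis by (simp add: rotation_action_def compose_def)
    qed
  qed
  then have "rotation_action n k \<in> hom (integer_mod_group n) (BijGroup ?X)"
    using n in_Bij by (intro homI) (auto simp: BijGroup_def carrier_integer_mod_group)
  then show ?thesis
    unfolding group_action_def
    by (intro group_hom.intro group_hom_axioms.intro) (simp_all add: group_BijGroup)
qed

section \<open>The generator of the cyclic group and the evaluation of the polynomial\<close>

lemma generate_integer_mod_group_1:
  assumes n: "n \<ge> 2"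
  shows "generate (integer_mod_group n) {1} = carrier (integer_mod_group n)"
proof -
  interpret group "integer_mod_group n" by simp
  have "generate (integer_mod_group n) {1} = {i mod int n | i. i \<in> UNIV}"
    using n by (subst generate_pow) (auto simp: int_pow_integer_mod_group)
  also have "\<dots> = {0..<int n}"
  proof
    show "{0..<int n} \<subseteq> {i mod int n | i. i \<in> UNIV}"
      by (auto intro!: exI mod_pos_pos_trivial[symmetric])
  qed (use n in auto)
  finally show ?thesis using n by (simp add: carrier_integer_mod_group)
qed

lemma ord_integer_mod_group_1:
  assumes n: "n \<ge> 2"
  shows "group.ord (integer_mod_group n) 1 = n"
proof -
  interpret group "integer_mod_group n" by simp
  show ?thesis
    using n by (subst generate_pow_card) (simp_all add: generate_integer_mod_group_1 carrier_integer_mod_group)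
qed

text \<open>\<open>[:0, 1:]\<close> is the indeterminate \<open>q\<close>; the variables are
  numbered from 1, so the exponent \<open>i - 1\<close> yields the arguments 1, \<open>q\<close>,
  and so on up to the power \<open>n - 1\<close>.\<close>

lemma poly_complete_homogeneous_nat:
  fixes z :: complex
  shows "poly (map_poly of_nat (complete_homogeneous_partition [k, k] n (\<lambda>i. [:0, 1:] ^ (i - 1)))) z =
    (complete_homogeneous k n (\<lambda>i. z ^ (i - 1)))\<^sup>2"
proof -
  define \<phi> where "\<phi> p = poly (map_poly of_nat p) z" for p :: "nat poly"
  have hom: "\<phi> 0 = 0" "\<phi> 1 = 1" "\<And>p q. \<phi> (p + q) = \<phi> p + \<phi> q" "\<And>p q. \<phi> (p * q) = \<phi> p * \<phi> q"
    unfolding \<phi>_def by (rule poly_nat_eval_hom)+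
  have "\<phi> [:0, 1:] = z" by (simp add: \<phi>_def map_poly_pCons)
  then have "\<phi> ([:0, 1:] ^ j) = z ^ j" for j
    by (induction j) (simp_all only: hom power_0 power_Suc)
  then have "\<phi> (complete_homogeneous k n (\<lambda>i. [:0, 1:] ^ (i - 1))) = complete_homogeneous k n (\<lambda>i. z ^ (i - 1))"
    by (simp only: complete_homogeneous_hom[of \<phi>, OF hom])
  then show ?thesis
    unfolding \<phi>_def[symmetric] complete_homogeneous_partition_def by (simp add: hom power2_eq_square)
qed

theorem theorem3p4:
  fixes n k :: nat
  assumes "n \<ge> 2"
  shows "exhibits_csp (integer_mod_group n) 1 (rotation_action n k) (c_multidissections n k)
           (complete_homogeneous_partition [k, k] n (\<lambda>i. [:0, 1:] ^ (i - 1)))"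
  unfolding exhibits_csp_def ord_integer_mod_group_1[OF assms]
proof (intro conjI allI impI)
  have n: "n > 0" using assms by simp
  show "finite (c_multidissections n k)" by (rule finite_c_multidissections[OF n])
  show "finite (carrier (integer_mod_group n))" "1 \<in> carrier (integer_mod_group n)"
    using assms by (simp_all add: carrier_integer_mod_group)
  show "carrier (integer_mod_group n) = generate (integer_mod_group n) {1}"
    by (rule generate_integer_mod_group_1[OF assms, symmetric])
  show "group_action (integer_mod_group n) (c_multidissections n k) (rotation_action n k)"
    by (rule group_action_rotation[OF n])
  fix \<zeta> :: complex and d :: nat
  assume \<zeta>: "has_mult_order \<zeta> n"
  \<comment> \<open>The group power of the generator is the representative of \<open>d\<close>
    modulo \<open>n\<close>, whereas the polynomial is evaluated at \<open>\<zeta> ^ d\<close>.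
    Since \<open>\<zeta> ^ n = 1\<close>, both can be expressed through \<open>e\<close>.\<close>
  define e where "e = d mod n"
  have "\<zeta> ^ d = (\<zeta> ^ n) ^ (d div n) * \<zeta> ^ e"
    by (simp add: e_def flip: power_mult power_add)
  then have \<zeta>_pow: "\<zeta> ^ d = \<zeta> ^ e" using \<zeta> by (simp add: has_mult_order_def)
  have "1 [^]\<^bsub>integer_mod_group n\<^esub> d = int e"
    by (simp add: e_def zmod_int)
  then have "invariants (c_multidissections n k) (rotation_action n k) (1 [^]\<^bsub>integer_mod_group n\<^esub> d) =
      {f \<in> c_multidissections n k. (rotate_multidissection n ^^ e) f = f}"
    by (auto simp: invariants_def rotation_action_def)
  then show "of_nat (card (invariants (c_multidissections n k) (rotation_action n k) (1 [^]\<^bsub>integer_mod_group n\<^esub> d))) =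
      poly (map_poly of_nat (complete_homogeneous_partition [k, k] n (\<lambda>i. [:0, 1:] ^ (i - 1)))) (\<zeta> ^ d)"
    by (simp only: card_rotation_fixed[OF n] of_nat_power card_periodic_sum_roots_of_unity[OF n \<zeta>]
        poly_complete_homogeneous_nat \<zeta>_pow)
qed

end
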